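(* Let $\Bbbk$ be a field. The category $\mathsf{XMod(Lbnz)}$ of crossed modules of Leibniz algebras over $\Bbbk$ and the category $\mathsf{Cat(Lbnz)}$ of internal categories (equivalently, internal groupoids) in the category of Leibniz algebras over $\Bbbk$ are naturally equivalent.
   Context: A Leibniz algebra is a $\Bbbk$-vector space $L$ with a bilinear map $[-,-]\colon L\times L\to L$ satisfying $[x,[y,z]]=[[x,y],z]-[[x,z],y]$ for all $x,y,z\in L$. A Leibniz algebra morphism is a $\Bbbk$-linear map $f$ with $f[x,y]=[f(x),f(y)]$. The resulting category is $\mathsf{Lbnz}$. A Leibniz action of $L$ on $L'$ consists of two bilinear maps $L\times L'\to L'$, $(x,m)\mapsto x\cdot m$, and $L'\times L\to L'$, $(m,x)\mapsto m\cdot x$, such that for all $x,y\in L$, $m,n\in L'$: (i) $x\cdot[m,n]=[x\cdot m,n]-[x\cdot n,m]$; (ii) $[m,x\cdot n]=[m\cdot x,n]-[m,n]\cdot x$; (iii) $[m,n\cdot x]=[m,n]\cdot x-[m\cdot x,n]$; (iv) $x\cdot(y\cdot m)=[x,y]\cdot m-(x\cdot m)\cdot y$; (v) $x\cdot(m\cdot y)=(x\cdot m)\cdot y-[x,y]\cdot m$; (vi) $m\cdot[x,y]=(m\cdot x)\cdot y-(m\cdot y)\cdot x$. A crossed module $(L_1,L_0,\partial)$ of Leibniz algebras is a Leibniz algebra morphism $\partial\colon L_1\to L_0$ together with a Leibniz action of $L_0$ on $L_1$ such that for all $l_0\in L_0$, $l_1,l_1'\in L_1$: $\partial(l_0\cdot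 l_1)=[l_0,\partial(l_1)]$, $\partial(l_1\cdot l_0)=[\partial(l_1),l_0]$, $l_1\cdot\partial(l_1')=[l_1,l_1']$, and $\partial(l_1')\cdot l_1=[l_1',l_1]$. A morphism $(L_1,L_0,\partial)\to(M_1,M_0,\delta)$ is a pair $(f_1,f_0)$ of Leibniz algebra morphisms $f_1\colon L_1\to M_1$, $f_0\colon L_0\to M_0$ with $f_0\partial=\delta f_1$, $f_1(l_0\cdot l_1)=f_0(l_0)\cdot f_1(l_1)$ and $f_1(l_1\cdot l_0)=f_1(l_1)\cdot f_0(l_0)$ for all $l_0\in L_0$, $l_1\in L_1$. An internal category $G$ in $\mathsf{Lbnz}$ is a category whose set of morphisms (also denoted $G$) and set of objects $\mathrm{Ob}(G)$ are Leibniz algebras, such that the source and target maps $d_0,d_1\colon G\to \mathrm{Ob}(G)$, the identity map $\varepsilon\colon \mathrm{Ob}(G)\to G$, and the composition $\circ\colon \{(h,g)\in G\times G: d_0(h)=d_1(g)\}\to G$, $(h,g)\mapsto h\circ g$, are Leibniz algebra morphisms (the pullback being a subalgebra of $G\times G$ with componentwise operations). Such a $G$ is an internal groupoid if every morphism is invertible; every internal category in $\mathsf{Lbnz}$ is an internal groupoid. A morphism of internal categories is a functor that is a Leibniz algebra morphism both on morphisms and on objects. *)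

theory Defs
  imports "HOL-Algebra.Module" "HOL-Library.FuncSet"
begin

section \<open>Categories and their equivalence\<close>

record ('o, 'm) category =
  Obj :: "'o set"
  Arr :: "'m set"
  Dom :: "'m \<Rightarrow> 'o"
  Cod :: "'m \<Rightarrow> 'o"
  Ident :: "'o \<Rightarrow> 'm"
  Comp :: "'m \<Rightarrow> 'm \<Rightarrow> 'm"

definition Hom :: "('o, 'm) category \<Rightarrow> 'o \<Rightarrow> 'o \<Rightarrow> 'm set" where
  "Hom C X Y = {f \<in> Arr C. Dom C f = X \<and> Cod C f = Y}"

locale category =
  fixes C :: "('o, 'm) category"
  assumes dom_closed: "f \<in> Arr C \<Longrightarrow> Dom C f \<in> Obj C"
    and cod_closed: "f \<in> Arr C \<Longrightarrow> Cod C f \<in> Obj C"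
    and ident_closed: "X \<in> Obj C \<Longrightarrow> Ident C X \<in> Hom C X X"
    and comp_closed: "g \<in> Hom C Y Z \<Longrightarrow> f \<in> Hom C X Y \<Longrightarrow> Comp C g f \<in> Hom C X Z"
    and ident_left: "f \<in> Hom C X Y \<Longrightarrow> Comp C (Ident C Y) f = f"
    and ident_right: "f \<in> Hom C X Y \<Longrightarrow> Comp C f (Ident C X) = f"
    and comp_assoc: "h \<in> Hom C Y Z \<Longrightarrow> g \<in> Hom C X Y \<Longrightarrow> f \<in> Hom C W X \<Longrightarrow>
      Comp C h (Comp C g f) = Comp C (Comp C h g) f"

definition invertible :: "('o, 'm) category \<Rightarrow> 'm \<Rightarrow> bool" where
  "invertible C f \<longleftrightarrow> f \<in> Arr C \<and>
    (\<exists>g \<in> Hom C (Cod C f) (Dom C f).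
       Comp C g f = Ident C (Dom C f) \<and> Comp C f g = Ident C (Cod C f))"

locale cat_functor = C: category C + D: category D
  for C :: "('o, 'm) category" and D :: "('p, 'n) category" +
  fixes Fo :: "'o \<Rightarrow> 'p" and Fa :: "'m \<Rightarrow> 'n"
  assumes obj_closed: "X \<in> Obj C \<Longrightarrow> Fo X \<in> Obj D"
    and arr_closed: "f \<in> Hom C X Y \<Longrightarrow> Fa f \<in> Hom D (Fo X) (Fo Y)"
    and map_ident: "X \<in> Obj C \<Longrightarrow> Fa (Ident C X) = Ident D (Fo X)"
    and map_comp: "g \<in> Hom C Y Z \<Longrightarrow> f \<in> Hom C X Y \<Longrightarrow>
      Fa (Comp C g f) = Comp D (Fa g) (Fa f)"

locale natural_isomorphism =
  F: cat_functor C D Fo Fa + G: cat_functor C D Go Ga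
  for C :: "('o, 'm) category" and D :: "('p, 'n) category" and Fo Fa Go Ga +
  fixes \<eta> :: "'o \<Rightarrow> 'n"
  assumes component: "X \<in> Obj C \<Longrightarrow> \<eta> X \<in> Hom D (Fo X) (Go X)"
    and component_invertible: "X \<in> Obj C \<Longrightarrow> invertible D (\<eta> X)"
    and naturality: "f \<in> Hom C X Y \<Longrightarrow>
      Comp D (Ga f) (\<eta> X) = Comp D (\<eta> Y) (Fa f)"

definition naturally_equivalent :: "('o, 'm) category \<Rightarrow> ('p, 'n) category \<Rightarrow> bool" where
  "naturally_equivalent C D \<longleftrightarrow>
    (\<exists>Fo Fa Go Ga \<eta> \<epsilon>.
      cat_functor C D Fo Fa \<and> cat_functor D C Go Ga \<and>
      natural_isomorphism C C id id (Go \<circ> Fo) (Ga \<circ> Fa) \<eta> \<and>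
      natural_isomorphism D D (Fo \<circ> Go) (Fa \<circ> Ga) id id \<epsilon>)"

definition full_subcategory :: "('o, 'm) category \<Rightarrow> ('o \<Rightarrow> bool) \<Rightarrow> ('o, 'm) category" where
  "full_subcategory C P =
    C \<lparr>Obj := {X \<in> Obj C. P X}, Arr := {f \<in> Arr C. P (Dom C f) \<and> P (Cod C f)}\<rparr>"


section \<open>Leibniz algebras\<close>

definition linear_maps ::
  "('k, 'e) ring_scheme \<Rightarrow> ('k, 'a) module \<Rightarrow> ('k, 'b) module \<Rightarrow> ('a \<Rightarrow> 'b) set" where
  "linear_maps K A B = {f \<in> carrier A \<rightarrow> carrier B.
    (\<forall>x \<in> carrier A. \<forall>y \<in> carrier A. f (x \<oplus>\<^bsub>A\<^esub> y) = f x \<oplus>\<^bsub>B\<^esub> f y) \<and>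
    (\<forall>c \<in> carrier K. \<forall>x \<in> carrier A. f (c \<odot>\<^bsub>A\<^esub> x) = c \<odot>\<^bsub>B\<^esub> f x)}"

definition bilinear_maps ::
  "('k, 'e) ring_scheme \<Rightarrow> ('k, 'a) module \<Rightarrow> ('k, 'b) module \<Rightarrow> ('k, 'c) module \<Rightarrow>
    ('a \<Rightarrow> 'b \<Rightarrow> 'c) set" where
  "bilinear_maps K A B C = {f.
    (\<forall>x \<in> carrier A. (\<lambda>y. f x y) \<in> linear_maps K B C) \<and>
    (\<forall>y \<in> carrier B. (\<lambda>x. f x y) \<in> linear_maps K A C)}"

text \<open>As in the locale \<^locale>\<open>algebra\<close>, the multiplication slot of the \<^typ>\<open>('k, 'a) module\<close>
  record carries the product of the algebra: \<open>x \<otimes>\<^bsub>L\<^esub> y\<close> is the Leibniz bracket \<open>[x, y]\<close>.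
  The slot \<open>one\<close> of that record is unconstrained and never used.\<close>

locale leibniz_algebra = field K + module K L
  for K :: "('k, 'e) ring_scheme" (structure) and L :: "('k, 'a) module" (structure) +
  assumes bracket_bilinear: "(\<lambda>x y. x \<otimes>\<^bsub>L\<^esub> y) \<in> bilinear_maps K L L L"
    and leibniz_identity: "x \<in> carrier L \<Longrightarrow> y \<in> carrier L \<Longrightarrow> z \<in> carrier L \<Longrightarrow>
      x \<otimes>\<^bsub>L\<^esub> (y \<otimes>\<^bsub>L\<^esub> z) = ((x \<otimes>\<^bsub>L\<^esub> y) \<otimes>\<^bsub>L\<^esub> z) \<ominus>\<^bsub>L\<^esub> ((x \<otimes>\<^bsub>L\<^esub> z) \<otimes>\<^bsub>L\<^esub> y)"

definition leibniz_hom ::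
  "('k, 'e) ring_scheme \<Rightarrow> ('k, 'a) module \<Rightarrow> ('k, 'b) module \<Rightarrow> ('a \<Rightarrow> 'b) set" where
  "leibniz_hom K A B = {f \<in> linear_maps K A B.
    \<forall>x \<in> carrier A. \<forall>y \<in> carrier A. f (x \<otimes>\<^bsub>A\<^esub> y) = f x \<otimes>\<^bsub>B\<^esub> f y}"

definition leibniz_prod ::
  "('k, 'a) module \<Rightarrow> ('k, 'b) module \<Rightarrow> ('k, 'a \<times> 'b) module" where
  "leibniz_prod A B =
    \<lparr>carrier = carrier A \<times> carrier B,
     mult = (\<lambda>(a, b) (a', b'). (a \<otimes>\<^bsub>A\<^esub> a', b \<otimes>\<^bsub>B\<^esub> b')),
     one = (\<one>\<^bsub>A\<^esub>, \<one>\<^bsub>B\<^esub>),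
     zero = (\<zero>\<^bsub>A\<^esub>, \<zero>\<^bsub>B\<^esub>),
     add = (\<lambda>(a, b) (a', b'). (a \<oplus>\<^bsub>A\<^esub> a', b \<oplus>\<^bsub>B\<^esub> b')),
     smult = (\<lambda>c (a, b). (c \<odot>\<^bsub>A\<^esub> a, c \<odot>\<^bsub>B\<^esub> b))\<rparr>"


section \<open>Crossed modules of Leibniz algebras\<close>

text \<open>In \<open>leibniz_action K L M l r\<close> the algebra \<open>L\<close> acts on \<open>M\<close>; for \<open>x \<in> L\<close> and \<open>m \<in> M\<close>,
  \<open>l x m\<close> is \<open>x \<cdot> m\<close> and \<open>r m x\<close> is \<open>m \<cdot> x\<close>.\<close>

locale leibniz_action =
  L: leibniz_algebra K L + M: leibniz_algebra K M
  for K :: "('k, 'e) ring_scheme" (structure)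
    and L :: "('k, 'a) module" (structure) and M :: "('k, 'b) module" (structure) +
  fixes l :: "'a \<Rightarrow> 'b \<Rightarrow> 'b" and r :: "'b \<Rightarrow> 'a \<Rightarrow> 'b"
  assumes left_bilinear: "l \<in> bilinear_maps K L M M"
    and right_bilinear: "r \<in> bilinear_maps K M L M"
    and action_i: "x \<in> carrier L \<Longrightarrow> m \<in> carrier M \<Longrightarrow> n \<in> carrier M \<Longrightarrow>
      l x (m \<otimes>\<^bsub>M\<^esub> n) = (l x m \<otimes>\<^bsub>M\<^esub> n) \<ominus>\<^bsub>M\<^esub> (l x n \<otimes>\<^bsub>M\<^esub> m)"
    and action_ii: "x \<in> carrier L \<Longrightarrow> m \<in> carrier M \<Longrightarrow> n \<in> carrier M \<Longrightarrow>
      m \<otimes>\<^bsub>M\<^esub> l x n = (r m x \<otimes>\<^bsub>M\<^esub> n) \<ominus>\<^bsub>M\<^esub> r (m \<otimes>\<^bsub>M\<^esub> n) x"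
    and action_iii: "x \<in> carrier L \<Longrightarrow> m \<in> carrier M \<Longrightarrow> n \<in> carrier M \<Longrightarrow>
      m \<otimes>\<^bsub>M\<^esub> r n x = r (m \<otimes>\<^bsub>M\<^esub> n) x \<ominus>\<^bsub>M\<^esub> (r m x \<otimes>\<^bsub>M\<^esub> n)"
    and action_iv: "x \<in> carrier L \<Longrightarrow> y \<in> carrier L \<Longrightarrow> m \<in> carrier M \<Longrightarrow>
      l x (l y m) = l (x \<otimes>\<^bsub>L\<^esub> y) m \<ominus>\<^bsub>M\<^esub> r (l x m) y"
    and action_v: "x \<in> carrier L \<Longrightarrow> y \<in> carrier L \<Longrightarrow> m \<in> carrier M \<Longrightarrow>
      l x (r m y) = r (l x m) y \<ominus>\<^bsub>M\<^esub> l (x \<otimes>\<^bsub>L\<^esub> y) m"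
    and action_vi: "x \<in> carrier L \<Longrightarrow> y \<in> carrier L \<Longrightarrow> m \<in> carrier M \<Longrightarrow>
      r m (x \<otimes>\<^bsub>L\<^esub> y) = r (r m x) y \<ominus>\<^bsub>M\<^esub> r (r m y) x"

record ('k, 'u) xmod =
  top_alg :: "('k, 'u) module"
  base_alg :: "('k, 'u) module"
  boundary :: "'u \<Rightarrow> 'u"
  lact :: "'u \<Rightarrow> 'u \<Rightarrow> 'u"
  ract :: "'u \<Rightarrow> 'u \<Rightarrow> 'u"

locale crossed_module =
  leibniz_action K "base_alg X" "top_alg X" "lact X" "ract X"
  for K :: "('k, 'e) ring_scheme" (structure) and X :: "('k, 'u) xmod" +
  assumes boundary_hom: "boundary X \<in> leibniz_hom K (top_alg X) (base_alg X)"
    and boundary_lact: "x \<in> carrier (base_alg X) \<Longrightarrow> m \<in> carrier (top_alg X) \<Longrightarrow>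
      boundary X (lact X x m) = x \<otimes>\<^bsub>base_alg X\<^esub> boundary X m"
    and boundary_ract: "x \<in> carrier (base_alg X) \<Longrightarrow> m \<in> carrier (top_alg X) \<Longrightarrow>
      boundary X (ract X m x) = boundary X m \<otimes>\<^bsub>base_alg X\<^esub> x"
    and peiffer_right: "m \<in> carrier (top_alg X) \<Longrightarrow> m' \<in> carrier (top_alg X) \<Longrightarrow>
      ract X m (boundary X m') = m \<otimes>\<^bsub>top_alg X\<^esub> m'"
    and peiffer_left: "m \<in> carrier (top_alg X) \<Longrightarrow> m' \<in> carrier (top_alg X) \<Longrightarrow>
      lact X (boundary X m') m = m' \<otimes>\<^bsub>top_alg X\<^esub> m"

text \<open>An arrow, of crossed modules or of internal categories, is a pair of maps together with
  its source and target. The maps are extensional (\<^const>\<open>undefined\<close> outside the carrier), so that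
  two arrows are equal as soon as they agree on the carriers.\<close>

record ('o, 'u) pair_arrow =
  Src :: 'o
  Tgt :: 'o
  map\<^sub>1 :: "'u \<Rightarrow> 'u"
  map\<^sub>0 :: "'u \<Rightarrow> 'u"

definition xmod_arrow ::
  "('k, 'e) ring_scheme \<Rightarrow> (('k, 'u) xmod, 'u) pair_arrow \<Rightarrow> bool" where
  "xmod_arrow K f \<longleftrightarrow>
    (let X = Src f; Y = Tgt f; f1 = map\<^sub>1 f; f0 = map\<^sub>0 f in
      crossed_module K X \<and> crossed_module K Y \<and>
      f1 \<in> leibniz_hom K (top_alg X) (top_alg Y) \<inter> extensional (carrier (top_alg X)) \<and>
      f0 \<in> leibniz_hom K (base_alg X) (base_alg Y) \<inter> extensional (carrier (base_alg X)) \<and>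
      (\<forall>m \<in> carrier (top_alg X). f0 (boundary X m) = boundary Y (f1 m)) \<and>
      (\<forall>x \<in> carrier (base_alg X). \<forall>m \<in> carrier (top_alg X).
         f1 (lact X x m) = lact Y (f0 x) (f1 m) \<and> f1 (ract X m x) = ract Y (f1 m) (f0 x)))"

definition XMod_Lbnz ::
  "('k, 'e) ring_scheme \<Rightarrow> (('k, 'u) xmod, (('k, 'u) xmod, 'u) pair_arrow) category" where
  "XMod_Lbnz K =
    \<lparr>Obj = {X. crossed_module K X},
     Arr = {f. xmod_arrow K f},
     Dom = Src,
     Cod = Tgt,
     Ident = (\<lambda>X. \<lparr>Src = X, Tgt = X,
                   map\<^sub>1 = restrict id (carrier (top_alg X)),
                   map\<^sub>0 = restrict id (carrier (base_alg X))\<rparr>),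
     Comp = (\<lambda>g f. \<lparr>Src = Src f, Tgt = Tgt g,
                    map\<^sub>1 = compose (carrier (top_alg (Src f))) (map\<^sub>1 g) (map\<^sub>1 f),
                    map\<^sub>0 = compose (carrier (base_alg (Src f))) (map\<^sub>0 g) (map\<^sub>0 f)\<rparr>)\<rparr>"


section \<open>Internal categories in Leibniz algebras\<close>

record ('k, 'u) icat =
  mor_alg :: "('k, 'u) module"
  ob_alg :: "('k, 'u) module"
  d\<^sub>0 :: "'u \<Rightarrow> 'u"
  d\<^sub>1 :: "'u \<Rightarrow> 'u"
  unit_map :: "'u \<Rightarrow> 'u"
  comp_map :: "'u \<Rightarrow> 'u \<Rightarrow> 'u"

definition underlying_category :: "('k, 'u) icat \<Rightarrow> ('u, 'u) category" where
  "underlying_category G =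
    \<lparr>Obj = carrier (ob_alg G), Arr = carrier (mor_alg G), Dom = d\<^sub>0 G, Cod = d\<^sub>1 G,
     Ident = unit_map G, Comp = comp_map G\<rparr>"

definition composable_pairs :: "('k, 'u) icat \<Rightarrow> ('k, 'u \<times> 'u) module" where
  "composable_pairs G = (leibniz_prod (mor_alg G) (mor_alg G))
    \<lparr>carrier := {(h, g) \<in> carrier (mor_alg G) \<times> carrier (mor_alg G). d\<^sub>0 G h = d\<^sub>1 G g}\<rparr>"

locale internal_category =
  mor: leibniz_algebra K "mor_alg G" + ob: leibniz_algebra K "ob_alg G" +
  category "underlying_category G"
  for K :: "('k, 'e) ring_scheme" (structure) and G :: "('k, 'u) icat" +
  assumes source_hom: "d\<^sub>0 G \<in> leibniz_hom K (mor_alg G) (ob_alg G)"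
    and target_hom: "d\<^sub>1 G \<in> leibniz_hom K (mor_alg G) (ob_alg G)"
    and unit_hom: "unit_map G \<in> leibniz_hom K (ob_alg G) (mor_alg G)"
    and comp_hom: "(\<lambda>(h, g). comp_map G h g) \<in> leibniz_hom K (composable_pairs G) (mor_alg G)"

locale internal_groupoid = internal_category K G
  for K :: "('k, 'e) ring_scheme" (structure) and G :: "('k, 'u) icat" +
  assumes all_invertible: "g \<in> carrier (mor_alg G) \<Longrightarrow> invertible (underlying_category G) g"

definition icat_arrow ::
  "('k, 'e) ring_scheme \<Rightarrow> (('k, 'u) icat, 'u) pair_arrow \<Rightarrow> bool" where
  "icat_arrow K f \<longleftrightarrow>
    (let G = Src f; H = Tgt f; f1 = map\<^sub>1 f; f0 = map\<^sub>0 f in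
      internal_category K G \<and> internal_category K H \<and>
      f1 \<in> leibniz_hom K (mor_alg G) (mor_alg H) \<inter> extensional (carrier (mor_alg G)) \<and>
      f0 \<in> leibniz_hom K (ob_alg G) (ob_alg H) \<inter> extensional (carrier (ob_alg G)) \<and>
      cat_functor (underlying_category G) (underlying_category H) f0 f1)"

definition Cat_Lbnz ::
  "('k, 'e) ring_scheme \<Rightarrow> (('k, 'u) icat, (('k, 'u) icat, 'u) pair_arrow) category" where
  "Cat_Lbnz K =
    \<lparr>Obj = {G. internal_category K G},
     Arr = {f. icat_arrow K f},
     Dom = Src,
     Cod = Tgt,
     Ident = (\<lambda>G. \<lparr>Src = G, Tgt = G,
                   map\<^sub>1 = restrict id (carrier (mor_alg G)),
                   map\<^sub>0 = restrict id (carrier (ob_alg G))\<rparr>),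
     Comp = (\<lambda>g f. \<lparr>Src = Src f, Tgt = Tgt g,
                    map\<^sub>1 = compose (carrier (mor_alg (Src f))) (map\<^sub>1 g) (map\<^sub>1 f),
                    map\<^sub>0 = compose (carrier (ob_alg (Src f))) (map\<^sub>0 g) (map\<^sub>0 f)\<rparr>)\<rparr>"

definition Grpd_Lbnz ::
  "('k, 'e) ring_scheme \<Rightarrow> (('k, 'u) icat, (('k, 'u) icat, 'u) pair_arrow) category" where
  "Grpd_Lbnz K = full_subcategory (Cat_Lbnz K) (internal_groupoid K)"

text \<open>All carriers are subsets of one type \<open>'u\<close>, which plays the role of the universe of small
  sets. The theorem needs it to be infinite, so that, up to bijection, the subsets of \<open>'u\<close> are
  closed under binary products: the internal category of a crossed module lives on
  \<open>L\<^sub>1 \<times> L\<^sub>0\<close>.\<close>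

end

theory Submission
  imports Defs
begin

text \<open>In an internal category composition is forced: \<open>h \<circ> g = h - \<epsilon>(d\<^sub>0 h) + g\<close>. Hence every morphism \<open>g\<close>
  has the inverse \<open>\<epsilon>(d\<^sub>0 g) + \<epsilon>(d\<^sub>1 g) - g\<close>, and a pair of Leibniz homomorphisms that respects sources,
  targets and identities is a functor. The crossed module of an internal category is the restriction
  of \<open>d\<^sub>1\<close> to the kernel of \<open>d\<^sub>0\<close>, on which an object \<open>x\<close> acts by bracketing with \<open>\<epsilon> x\<close>; the interchange law
  for the bracket gives the Peiffer identities. Conversely a crossed module \<open>(L\<^sub>1, L\<^sub>0, \<partial>)\<close> gives the
  semidirect product \<open>L\<^sub>1 \<rtimes> L\<^sub>0\<close> with \<open>d\<^sub>0 (m, x) = x\<close>, \<open>d\<^sub>1 (m, x) = \<partial> m + x\<close> and \<open>\<epsilon> x = (0, x)\<close>. The natural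
  isomorphisms are \<open>m \<mapsto> (m, 0)\<close> and \<open>(m, x) \<mapsto> m + \<epsilon> x\<close>.\<close>

section \<open>Linear maps and Leibniz algebras\<close>

lemma linear_mapsD:
  assumes "f \<in> linear_maps K A B"
  shows "x \<in> carrier A \<Longrightarrow> f x \<in> carrier B"
    and "x \<in> carrier A \<Longrightarrow> y \<in> carrier A \<Longrightarrow> f (x \<oplus>\<^bsub>A\<^esub> y) = f x \<oplus>\<^bsub>B\<^esub> f y"
    and "c \<in> carrier K \<Longrightarrow> x \<in> carrier A \<Longrightarrow> f (c \<odot>\<^bsub>A\<^esub> x) = c \<odot>\<^bsub>B\<^esub> f x"
  using assms by (auto simp: linear_maps_def)

lemma linear_maps_zero:
  assumes f: "f \<in> linear_maps K A B" and "abelian_group A" "abelian_group B"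
  shows "f \<zero>\<^bsub>A\<^esub> = \<zero>\<^bsub>B\<^esub>"
proof -
  interpret A: abelian_group A by fact
  interpret B: abelian_group B by fact
  have "f \<zero>\<^bsub>A\<^esub> \<oplus>\<^bsub>B\<^esub> f \<zero>\<^bsub>A\<^esub> = f \<zero>\<^bsub>A\<^esub>"
    using linear_mapsD(2)[OF f, of "\<zero>\<^bsub>A\<^esub>" "\<zero>\<^bsub>A\<^esub>"] by simp
  then show ?thesis
    using linear_mapsD(1)[OF f, of "\<zero>\<^bsub>A\<^esub>"] by simp
qed

lemma linear_maps_a_inv:
  assumes f: "f \<in> linear_maps K A B" and "abelian_group A" "abelian_group B" and x: "x \<in> carrier A"
  shows "f (\<ominus>\<^bsub>A\<^esub> x) = \<ominus>\<^bsub>B\<^esub> f x"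
proof -
  interpret A: abelian_group A by fact
  interpret B: abelian_group B by fact
  have "f (\<ominus>\<^bsub>A\<^esub> x) \<oplus>\<^bsub>B\<^esub> f x = \<zero>\<^bsub>B\<^esub>"
    using x linear_mapsD(2)[OF f, of "\<ominus>\<^bsub>A\<^esub> x" x] linear_maps_zero[OF assms(1-3)]
    by (simp add: A.l_neg)
  then show ?thesis
    using x linear_mapsD(1)[OF f] by (simp add: B.minus_equality)
qed

lemma linear_maps_a_minus:
  assumes f: "f \<in> linear_maps K A B" and "abelian_group A" "abelian_group B"
    and x: "x \<in> carrier A" "y \<in> carrier A"
  shows "f (x \<ominus>\<^bsub>A\<^esub> y) = f x \<ominus>\<^bsub>B\<^esub> f y"
proof -
  interpret A: abelian_group A by fact
  show ?thesis
    using x by (simp add: a_minus_def linear_mapsD(2)[OF f] linear_maps_a_inv[OF assms(1-3)])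
qed

lemma bilinear_mapsI:
  assumes "\<And>x y. x \<in> carrier A \<Longrightarrow> y \<in> carrier B \<Longrightarrow> f x y \<in> carrier C"
    and "\<And>x x' y. x \<in> carrier A \<Longrightarrow> x' \<in> carrier A \<Longrightarrow> y \<in> carrier B \<Longrightarrow>
      f (x \<oplus>\<^bsub>A\<^esub> x') y = f x y \<oplus>\<^bsub>C\<^esub> f x' y"
    and "\<And>x y y'. x \<in> carrier A \<Longrightarrow> y \<in> carrier B \<Longrightarrow> y' \<in> carrier B \<Longrightarrow>
      f x (y \<oplus>\<^bsub>B\<^esub> y') = f x y \<oplus>\<^bsub>C\<^esub> f x y'"
    and "\<And>c x y. c \<in> carrier K \<Longrightarrow> x \<in> carrier A \<Longrightarrow> y \<in> carrier B \<Longrightarrow>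
      f (c \<odot>\<^bsub>A\<^esub> x) y = c \<odot>\<^bsub>C\<^esub> f x y"
    and "\<And>c x y. c \<in> carrier K \<Longrightarrow> x \<in> carrier A \<Longrightarrow> y \<in> carrier B \<Longrightarrow>
      f x (c \<odot>\<^bsub>B\<^esub> y) = c \<odot>\<^bsub>C\<^esub> f x y"
  shows "f \<in> bilinear_maps K A B C"
  using assms by (auto simp: bilinear_maps_def linear_maps_def)

lemma bilinear_mapsD:
  assumes "f \<in> bilinear_maps K A B C"
  shows "x \<in> carrier A \<Longrightarrow> y \<in> carrier B \<Longrightarrow> f x y \<in> carrier C"
    and "x \<in> carrier A \<Longrightarrow> x' \<in> carrier A \<Longrightarrow> y \<in> carrier B \<Longrightarrow>
      f (x \<oplus>\<^bsub>A\<^esub> x') y = f x y \<oplus>\<^bsub>C\<^esub> f x' y"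
    and "x \<in> carrier A \<Longrightarrow> y \<in> carrier B \<Longrightarrow> y' \<in> carrier B \<Longrightarrow>
      f x (y \<oplus>\<^bsub>B\<^esub> y') = f x y \<oplus>\<^bsub>C\<^esub> f x y'"
    and "c \<in> carrier K \<Longrightarrow> x \<in> carrier A \<Longrightarrow> y \<in> carrier B \<Longrightarrow>
      f (c \<odot>\<^bsub>A\<^esub> x) y = c \<odot>\<^bsub>C\<^esub> f x y"
    and "c \<in> carrier K \<Longrightarrow> x \<in> carrier A \<Longrightarrow> y \<in> carrier B \<Longrightarrow>
      f x (c \<odot>\<^bsub>B\<^esub> y) = c \<odot>\<^bsub>C\<^esub> f x y"
  using assms by (auto simp: bilinear_maps_def linear_maps_def)

lemma bilinear_maps_zero:
  assumes f: "f \<in> bilinear_maps K A B C"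
    and "abelian_group A" "abelian_group B" "abelian_group C"
  shows "x \<in> carrier A \<Longrightarrow> f x \<zero>\<^bsub>B\<^esub> = \<zero>\<^bsub>C\<^esub>"
    and "y \<in> carrier B \<Longrightarrow> f \<zero>\<^bsub>A\<^esub> y = \<zero>\<^bsub>C\<^esub>"
proof -
  show "f x \<zero>\<^bsub>B\<^esub> = \<zero>\<^bsub>C\<^esub>" if "x \<in> carrier A"
    using linear_maps_zero[of "f x" K B C] assms that by (auto simp: bilinear_maps_def)
  show "f \<zero>\<^bsub>A\<^esub> y = \<zero>\<^bsub>C\<^esub>" if "y \<in> carrier B"
    using linear_maps_zero[of "\<lambda>x. f x y" K A C] assms that by (auto simp: bilinear_maps_def)
qed

lemma leibniz_homI:
  assumes "\<And>x. x \<in> carrier A \<Longrightarrow> f x \<in> carrier B"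
    and "\<And>x y. x \<in> carrier A \<Longrightarrow> y \<in> carrier A \<Longrightarrow> f (x \<oplus>\<^bsub>A\<^esub> y) = f x \<oplus>\<^bsub>B\<^esub> f y"
    and "\<And>c x. c \<in> carrier K \<Longrightarrow> x \<in> carrier A \<Longrightarrow> f (c \<odot>\<^bsub>A\<^esub> x) = c \<odot>\<^bsub>B\<^esub> f x"
    and "\<And>x y. x \<in> carrier A \<Longrightarrow> y \<in> carrier A \<Longrightarrow> f (x \<otimes>\<^bsub>A\<^esub> y) = f x \<otimes>\<^bsub>B\<^esub> f y"
  shows "f \<in> leibniz_hom K A B"
  using assms by (auto simp: leibniz_hom_def linear_maps_def)

lemma leibniz_hom_linear: "f \<in> leibniz_hom K A B \<Longrightarrow> f \<in> linear_maps K A B"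
  by (simp add: leibniz_hom_def)

lemma leibniz_homD:
  assumes "f \<in> leibniz_hom K A B"
  shows "x \<in> carrier A \<Longrightarrow> f x \<in> carrier B"
    and "x \<in> carrier A \<Longrightarrow> y \<in> carrier A \<Longrightarrow> f (x \<oplus>\<^bsub>A\<^esub> y) = f x \<oplus>\<^bsub>B\<^esub> f y"
    and "c \<in> carrier K \<Longrightarrow> x \<in> carrier A \<Longrightarrow> f (c \<odot>\<^bsub>A\<^esub> x) = c \<odot>\<^bsub>B\<^esub> f x"
    and "x \<in> carrier A \<Longrightarrow> y \<in> carrier A \<Longrightarrow> f (x \<otimes>\<^bsub>A\<^esub> y) = f x \<otimes>\<^bsub>B\<^esub> f y"
  using assms by (auto simp: leibniz_hom_def linear_maps_def)

lemma leibniz_algebraI: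
  assumes "field K" "module K L"
    and "(\<lambda>x y. x \<otimes>\<^bsub>L\<^esub> y) \<in> bilinear_maps K L L L"
    and "\<And>x y z. x \<in> carrier L \<Longrightarrow> y \<in> carrier L \<Longrightarrow> z \<in> carrier L \<Longrightarrow>
      x \<otimes>\<^bsub>L\<^esub> (y \<otimes>\<^bsub>L\<^esub> z) = ((x \<otimes>\<^bsub>L\<^esub> y) \<otimes>\<^bsub>L\<^esub> z) \<ominus>\<^bsub>L\<^esub> ((x \<otimes>\<^bsub>L\<^esub> z) \<otimes>\<^bsub>L\<^esub> y)"
  shows "leibniz_algebra K L"
  using assms by (intro leibniz_algebra.intro leibniz_algebra_axioms.intro)

context leibniz_algebra
begin

lemmas bracket_closed [simp, intro] = bilinear_mapsD(1)[OF bracket_bilinear]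
  and bracket_add_left = bilinear_mapsD(2)[OF bracket_bilinear]
  and bracket_add_right = bilinear_mapsD(3)[OF bracket_bilinear]
  and bracket_smult_left = bilinear_mapsD(4)[OF bracket_bilinear]
  and bracket_smult_right = bilinear_mapsD(5)[OF bracket_bilinear]

lemma abelian_group: "abelian_group L" ..

lemmas bracket_zero [simp] = bilinear_maps_zero[OF bracket_bilinear abelian_group abelian_group abelian_group]

lemma restrict_id_hom: "restrict id (carrier L) \<in> leibniz_hom K L L"
  by (rule leibniz_homI) auto

text \<open>Moves the subtrahend to the other side. The axioms then become equations between sums,
  on which rewriting by associativity and commutativity works without inverses.\<close>

lemma eq_minus_iff:
  assumes "x \<in> carrier L" "y \<in> carrier L" "z \<in> carrier L"
  shows "x = y \<ominus>\<^bsub>L\<^esub> z \<longleftrightarrow> y = x \<oplus>\<^bsub>L\<^esub> z"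
  using assms by (auto simp: a_minus_def M.a_assoc M.l_neg M.r_neg)

lemma leibniz_identity_add:
  "x \<in> carrier L \<Longrightarrow> y \<in> carrier L \<Longrightarrow> z \<in> carrier L \<Longrightarrow>
   (x \<otimes>\<^bsub>L\<^esub> y) \<otimes>\<^bsub>L\<^esub> z = x \<otimes>\<^bsub>L\<^esub> (y \<otimes>\<^bsub>L\<^esub> z) \<oplus>\<^bsub>L\<^esub> (x \<otimes>\<^bsub>L\<^esub> z) \<otimes>\<^bsub>L\<^esub> y"
  by (simp flip: eq_minus_iff add: leibniz_identity)

lemma add_minus_cancel [simp]:
  assumes "x \<in> carrier L" "y \<in> carrier L"
  shows "x \<oplus>\<^bsub>L\<^esub> (y \<oplus>\<^bsub>L\<^esub> \<ominus>\<^bsub>L\<^esub> x) = y" "x \<oplus>\<^bsub>L\<^esub> (\<ominus>\<^bsub>L\<^esub> x \<oplus>\<^bsub>L\<^esub> y) = y"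
  using assms by (simp_all add: M.r_neg2 M.a_comm[of y])

end

section \<open>Composites and inverses of Leibniz homomorphisms, and subalgebras\<close>

lemma compose_leibniz_hom:
  assumes f: "f \<in> leibniz_hom K A B" and g: "g \<in> leibniz_hom K B C" and A: "leibniz_algebra K A"
  shows "compose (carrier A) g f \<in> leibniz_hom K A C"
proof -
  interpret leibniz_algebra K A by fact
  show ?thesis
    by (rule leibniz_homI) (auto simp: compose_eq leibniz_homD[OF f] leibniz_homD[OF g])
qed

text \<open>Since \<open>f\<close> is injective, an inverse image is identified by exhibiting a
  preimage; each clause then follows from the same clause for \<open>f\<close>. The restriction
  makes the inverse extensional, as arrows require.\<close>

lemma inv_into_leibniz_hom:
  assumes f: "f \<in> leibniz_hom K A B" and bij: "bij_betw f (carrier A) (carrier B)"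
    and "leibniz_algebra K A" "leibniz_algebra K B"
  shows "restrict (inv_into (carrier A) f) (carrier B) \<in> leibniz_hom K B A"
proof -
  interpret A: leibniz_algebra K A by fact
  interpret B: leibniz_algebra K B by fact
  let ?g = "inv_into (carrier A) f"
  have g: "?g y \<in> carrier A" "f (?g y) = y" if "y \<in> carrier B" for y
    using bij that by (auto simp: bij_betw_def intro: inv_into_into f_inv_into_f)
  have eq: "?g y = x" if "x \<in> carrier A" "f x = y" for x y
    using bij that by (auto simp: bij_betw_def)
  show ?thesis
    by (rule leibniz_homI) (auto simp: g intro!: eq simp: leibniz_homD[OF f])
qed

text \<open>The second claim is not automatic: \<open>a_inv\<close> is defined by a search through
  the carrier, so shrinking the carrier could change differences.\<close>

lemma leibniz_algebra_subalgebra: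
  assumes L: "leibniz_algebra K L" and H: "submodule H K L"
    and bracket: "\<And>x y. x \<in> H \<Longrightarrow> y \<in> H \<Longrightarrow> x \<otimes>\<^bsub>L\<^esub> y \<in> H"
  shows "leibniz_algebra K (L\<lparr>carrier := H\<rparr>)"
    and "y \<in> H \<Longrightarrow> x \<ominus>\<^bsub>L\<lparr>carrier := H\<rparr>\<^esub> y = x \<ominus>\<^bsub>L\<^esub> y"
proof -
  interpret leibniz_algebra K L by fact
  have sub: "H \<subseteq> carrier L"
    using submoduleE(1)[OF H] .
  have mod: "module K (L\<lparr>carrier := H\<rparr>)"
    using submodule.submodule_is_module[OF H] module_axioms by blast
  have minus: "x \<ominus>\<^bsub>L\<lparr>carrier := H\<rparr>\<^esub> y = x \<ominus>\<^bsub>L\<^esub> y" if "y \<in> H" for x y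
    using M.add.m_inv_consistent[OF submodule.axioms(1)[OF H] that]
    by (simp add: a_minus_def a_inv_def)
  then show "y \<in> H \<Longrightarrow> x \<ominus>\<^bsub>L\<lparr>carrier := H\<rparr>\<^esub> y = x \<ominus>\<^bsub>L\<^esub> y" .
  show "leibniz_algebra K (L\<lparr>carrier := H\<rparr>)"
  proof (rule leibniz_algebraI)
    show "(\<lambda>x y. x \<otimes>\<^bsub>L\<lparr>carrier := H\<rparr>\<^esub> y) \<in>
        bilinear_maps K (L\<lparr>carrier := H\<rparr>) (L\<lparr>carrier := H\<rparr>) (L\<lparr>carrier := H\<rparr>)"
      using sub bracket
      by (intro bilinear_mapsI)
        (auto simp: bracket_add_left bracket_add_right bracket_smult_left bracket_smult_right subset_iff)
  qed (use sub in \<open>auto simp: field_axioms mod minus bracket leibniz_identity subset_iff\<close>)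
qed

section \<open>Internal categories\<close>

context internal_category
begin

lemmas source_closed [simp, intro] = leibniz_homD(1)[OF source_hom]
  and target_closed [simp, intro] = leibniz_homD(1)[OF target_hom]
  and unit_closed [simp, intro] = leibniz_homD(1)[OF unit_hom]

lemmas source_simps [simp] = leibniz_homD(2-4)[OF source_hom]
    linear_maps_zero[OF leibniz_hom_linear[OF source_hom] mor.abelian_group ob.abelian_group]
    linear_maps_a_inv[OF leibniz_hom_linear[OF source_hom] mor.abelian_group ob.abelian_group]
    linear_maps_a_minus[OF leibniz_hom_linear[OF source_hom] mor.abelian_group ob.abelian_group]
  and target_simps [simp] = leibniz_homD(2-4)[OF target_hom]
    linear_maps_zero[OF leibniz_hom_linear[OF target_hom] mor.abelian_group ob.abelian_group]
    linear_maps_a_inv[OF leibniz_hom_linear[OF target_hom] mor.abelian_group ob.abelian_group]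
    linear_maps_a_minus[OF leibniz_hom_linear[OF target_hom] mor.abelian_group ob.abelian_group]
  and unit_simps [simp] = leibniz_homD(2-4)[OF unit_hom]
    linear_maps_zero[OF leibniz_hom_linear[OF unit_hom] ob.abelian_group mor.abelian_group]
    linear_maps_a_inv[OF leibniz_hom_linear[OF unit_hom] ob.abelian_group mor.abelian_group]
    linear_maps_a_minus[OF leibniz_hom_linear[OF unit_hom] ob.abelian_group mor.abelian_group]

lemma source_unit [simp]: "x \<in> carrier (ob_alg G) \<Longrightarrow> d\<^sub>0 G (unit_map G x) = x"
  and target_unit [simp]: "x \<in> carrier (ob_alg G) \<Longrightarrow> d\<^sub>1 G (unit_map G x) = x"
  using ident_closed by (auto simp: underlying_category_def Hom_def)

lemma comp_unit_left [simp]: "g \<in> carrier (mor_alg G) \<Longrightarrow> comp_map G (unit_map G (d\<^sub>1 G g)) g = g"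
  and comp_unit_right [simp]: "g \<in> carrier (mor_alg G) \<Longrightarrow> comp_map G g (unit_map G (d\<^sub>0 G g)) = g"
  using ident_left ident_right by (auto simp: underlying_category_def Hom_def)

lemma composable_carrier:
  "(h, g) \<in> carrier (composable_pairs G) \<longleftrightarrow>
    h \<in> carrier (mor_alg G) \<and> g \<in> carrier (mor_alg G) \<and> d\<^sub>0 G h = d\<^sub>1 G g"
  by (simp add: composable_pairs_def)

text \<open>The interchange law between composition and addition, read off from
  \<open>comp_hom\<close> at two elements of the pullback.\<close>

lemma comp_add:
  assumes "h \<in> carrier (mor_alg G)" "g \<in> carrier (mor_alg G)" "d\<^sub>0 G h = d\<^sub>1 G g"
    and "h' \<in> carrier (mor_alg G)" "g' \<in> carrier (mor_alg G)" "d\<^sub>0 G h' = d\<^sub>1 G g'"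
  shows "comp_map G (h \<oplus>\<^bsub>mor_alg G\<^esub> h') (g \<oplus>\<^bsub>mor_alg G\<^esub> g') =
    comp_map G h g \<oplus>\<^bsub>mor_alg G\<^esub> comp_map G h' g'"
  using leibniz_homD(2)[OF comp_hom, of "(h, g)" "(h', g')"] assms
  unfolding composable_carrier by (simp add: composable_pairs_def leibniz_prod_def)

lemma comp_bracket:
  assumes "h \<in> carrier (mor_alg G)" "g \<in> carrier (mor_alg G)" "d\<^sub>0 G h = d\<^sub>1 G g"
    and "h' \<in> carrier (mor_alg G)" "g' \<in> carrier (mor_alg G)" "d\<^sub>0 G h' = d\<^sub>1 G g'"
  shows "comp_map G (h \<otimes>\<^bsub>mor_alg G\<^esub> h') (g \<otimes>\<^bsub>mor_alg G\<^esub> g') =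
    comp_map G h g \<otimes>\<^bsub>mor_alg G\<^esub> comp_map G h' g'"
  using leibniz_homD(4)[OF comp_hom, of "(h, g)" "(h', g')"] assms
  unfolding composable_carrier by (simp add: composable_pairs_def leibniz_prod_def)

text \<open>With \<open>u\<close> the identity at \<open>d\<^sub>0 G h\<close>, the pair
  \<open>(h, g)\<close> is the sum of the composable pairs \<open>(h, u)\<close> and
  \<open>(0, g - u)\<close>. Composition is additive, and the unit laws evaluate it on both
  summands.\<close>

lemma comp_eq:
  assumes h: "h \<in> carrier (mor_alg G)" and g: "g \<in> carrier (mor_alg G)" and "d\<^sub>0 G h = d\<^sub>1 G g"
  shows "comp_map G h g = h \<oplus>\<^bsub>mor_alg G\<^esub> (g \<ominus>\<^bsub>mor_alg G\<^esub> unit_map G (d\<^sub>0 G h))"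
proof -
  let ?u = "unit_map G (d\<^sub>0 G h)" and ?k = "g \<ominus>\<^bsub>mor_alg G\<^esub> unit_map G (d\<^sub>0 G h)"
  have k: "?k \<in> carrier (mor_alg G)" "d\<^sub>1 G ?k = \<zero>\<^bsub>ob_alg G\<^esub>"
    using assms by (auto simp: a_minus_def ob.M.r_neg)
  have "comp_map G (h \<oplus>\<^bsub>mor_alg G\<^esub> \<zero>\<^bsub>mor_alg G\<^esub>) (?u \<oplus>\<^bsub>mor_alg G\<^esub> ?k)
      = comp_map G h ?u \<oplus>\<^bsub>mor_alg G\<^esub> comp_map G \<zero>\<^bsub>mor_alg G\<^esub> ?k"
    using h g k by (intro comp_add) auto
  \<comment> \<open>Zero is the identity at the zero object, which is the target of
    \<open>?k\<close>.\<close>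
  moreover have "comp_map G \<zero>\<^bsub>mor_alg G\<^esub> ?k = ?k"
    using comp_unit_left[OF k(1)] k(2) by simp
  moreover have "?u \<oplus>\<^bsub>mor_alg G\<^esub> ?k = g"
    using h g by (simp add: a_minus_def mor.M.a_lcomm mor.M.r_neg)
  ultimately show ?thesis
    using h by simp
qed

text \<open>Interchange law: \<open>[h, g] = [h \<circ> 0, \<epsilon>(d\<^sub>1 g) \<circ> g] = [h, \<epsilon>(d\<^sub>1 g)] \<circ> [0, g]\<close>, and symmetrically.\<close>

lemma kernel_bracket:
  assumes "h \<in> carrier (mor_alg G)" "d\<^sub>0 G h = \<zero>\<^bsub>ob_alg G\<^esub>"
    and "g \<in> carrier (mor_alg G)" "d\<^sub>0 G g = \<zero>\<^bsub>ob_alg G\<^esub>"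
  shows "h \<otimes>\<^bsub>mor_alg G\<^esub> unit_map G (d\<^sub>1 G g) = h \<otimes>\<^bsub>mor_alg G\<^esub> g"
    and "unit_map G (d\<^sub>1 G g) \<otimes>\<^bsub>mor_alg G\<^esub> h = g \<otimes>\<^bsub>mor_alg G\<^esub> h"
proof -
  let ?u = "unit_map G (d\<^sub>1 G g)"
  have comp_zero: "comp_map G k \<zero>\<^bsub>mor_alg G\<^esub> = k"
    if "k \<in> carrier (mor_alg G)" "d\<^sub>0 G k = \<zero>\<^bsub>ob_alg G\<^esub>" for k
    using comp_unit_right[of k] that by simp
  have "comp_map G (h \<otimes>\<^bsub>mor_alg G\<^esub> ?u) (\<zero>\<^bsub>mor_alg G\<^esub> \<otimes>\<^bsub>mor_alg G\<^esub> g)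
      = comp_map G h \<zero>\<^bsub>mor_alg G\<^esub> \<otimes>\<^bsub>mor_alg G\<^esub> comp_map G ?u g"
    using assms by (intro comp_bracket) auto
  then show "h \<otimes>\<^bsub>mor_alg G\<^esub> ?u = h \<otimes>\<^bsub>mor_alg G\<^esub> g"
    using assms by (simp add: comp_zero)
  have "comp_map G (?u \<otimes>\<^bsub>mor_alg G\<^esub> h) (g \<otimes>\<^bsub>mor_alg G\<^esub> \<zero>\<^bsub>mor_alg G\<^esub>)
      = comp_map G ?u g \<otimes>\<^bsub>mor_alg G\<^esub> comp_map G h \<zero>\<^bsub>mor_alg G\<^esub>"
    using assms by (intro comp_bracket) auto
  then show "?u \<otimes>\<^bsub>mor_alg G\<^esub> h = g \<otimes>\<^bsub>mor_alg G\<^esub> h"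
    using assms by (simp add: comp_zero)
qed

lemma morphism_invertible:
  assumes g: "g \<in> carrier (mor_alg G)"
  shows "invertible (underlying_category G) g"
proof -
  \<comment> \<open>Obtained by solving
    \<open>h + (g - \<epsilon>(d\<^sub>1 g)) = \<epsilon>(d\<^sub>0 g)\<close>, which is what
    \<open>comp_eq\<close> makes of the left inverse law.\<close>
  define h where "h = unit_map G (d\<^sub>0 G g) \<oplus>\<^bsub>mor_alg G\<^esub> (unit_map G (d\<^sub>1 G g) \<ominus>\<^bsub>mor_alg G\<^esub> g)"
  have h: "h \<in> carrier (mor_alg G)" "d\<^sub>0 G h = d\<^sub>1 G g" "d\<^sub>1 G h = d\<^sub>0 G g"
    using g by (auto simp: h_def a_minus_def ob.M.r_neg)
  have "comp_map G h g = unit_map G (d\<^sub>0 G g)"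
    using g h by (subst comp_eq)
      (auto simp: h_def a_minus_def mor.M.a_ac mor.M.r_neg mor.M.r_neg1 mor.M.r_neg2)
  moreover have "comp_map G g h = unit_map G (d\<^sub>1 G g)"
    using g h by (subst comp_eq)
      (auto simp: h_def a_minus_def mor.M.a_ac mor.M.r_neg mor.M.r_neg1 mor.M.r_neg2)
  ultimately show ?thesis
    using g h unfolding invertible_def
    by (auto simp: underlying_category_def Hom_def intro!: exI[of _ h])
qed

end

lemma internal_groupoid_iff: "internal_groupoid K G \<longleftrightarrow> internal_category K G"
  by (metis internal_category.morphism_invertible internal_groupoid.axioms(1)
      internal_groupoid.intro internal_groupoid_axioms.intro)

text \<open>Preservation of composition can be left out of the right-hand side: by
  \<open>comp_eq\<close> a composite is a sum and difference of \<open>h\<close>, \<open>g\<close>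
  and an identity, and the remaining clauses preserve all of these.\<close>

lemma icat_arrow_iff:
  "icat_arrow K f \<longleftrightarrow>
    internal_category K (Src f) \<and> internal_category K (Tgt f) \<and>
    map\<^sub>1 f \<in> leibniz_hom K (mor_alg (Src f)) (mor_alg (Tgt f)) \<and>
    map\<^sub>1 f \<in> extensional (carrier (mor_alg (Src f))) \<and>
    map\<^sub>0 f \<in> leibniz_hom K (ob_alg (Src f)) (ob_alg (Tgt f)) \<and>
    map\<^sub>0 f \<in> extensional (carrier (ob_alg (Src f))) \<and>
    (\<forall>g \<in> carrier (mor_alg (Src f)). d\<^sub>0 (Tgt f) (map\<^sub>1 f g) = map\<^sub>0 f (d\<^sub>0 (Src f) g) \<and>
       d\<^sub>1 (Tgt f) (map\<^sub>1 f g) = map\<^sub>0 f (d\<^sub>1 (Src f) g)) \<and>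
    (\<forall>x \<in> carrier (ob_alg (Src f)). map\<^sub>1 f (unit_map (Src f) x) = unit_map (Tgt f) (map\<^sub>0 f x))"
  (is "_ \<longleftrightarrow> ?R")
proof
  assume f: "icat_arrow K f"
  then interpret cat_functor "underlying_category (Src f)" "underlying_category (Tgt f)" "map\<^sub>0 f" "map\<^sub>1 f"
    by (auto simp: icat_arrow_def Let_def)
  show ?R
    using f arr_closed map_ident
    by (auto simp: icat_arrow_def Let_def underlying_category_def Hom_def)
next
  assume R: ?R
  interpret G: internal_category K "Src f" using R by simp
  interpret H: internal_category K "Tgt f" using R by simp
  have h1: "map\<^sub>1 f \<in> leibniz_hom K (mor_alg (Src f)) (mor_alg (Tgt f))"
    and h0: "map\<^sub>0 f \<in> leibniz_hom K (ob_alg (Src f)) (ob_alg (Tgt f))"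
    using R by auto
  note minus = linear_maps_a_minus[OF leibniz_hom_linear[OF h1] G.mor.abelian_group H.mor.abelian_group]
  have comp: "map\<^sub>1 f (comp_map (Src f) h g) = comp_map (Tgt f) (map\<^sub>1 f h) (map\<^sub>1 f g)"
    if "h \<in> carrier (mor_alg (Src f))" "g \<in> carrier (mor_alg (Src f))"
      "d\<^sub>0 (Src f) h = d\<^sub>1 (Src f) g" for h g
    using that R by (subst G.comp_eq H.comp_eq; simp add: leibniz_homD[OF h1] leibniz_homD[OF h0] minus)+
  have "cat_functor (underlying_category (Src f)) (underlying_category (Tgt f)) (map\<^sub>0 f) (map\<^sub>1 f)"
    using R by unfold_locales
      (auto simp: underlying_category_def Hom_def leibniz_homD[OF h1] leibniz_homD[OF h0] comp)
  with R show "icat_arrow K f"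
    by (simp add: icat_arrow_def Let_def)
qed

section \<open>Functors, and categories whose arrows are pairs of maps\<close>

lemma functor_id: "category C \<Longrightarrow> cat_functor C C id id"
  by (intro cat_functor.intro cat_functor_axioms.intro) (auto simp: category.ident_closed)

lemma functor_comp:
  assumes "cat_functor C D Fo Fa" "cat_functor D E Go Ga"
  shows "cat_functor C E (Go \<circ> Fo) (Ga \<circ> Fa)"
proof -
  interpret F: cat_functor C D Fo Fa by fact
  interpret G: cat_functor D E Go Ga by fact
  show ?thesis
    by unfold_locales
      (auto simp: F.obj_closed G.obj_closed F.map_ident G.map_ident F.map_comp F.arr_closed
        G.map_comp[OF F.arr_closed F.arr_closed] intro: G.arr_closed F.arr_closed)
qed

text \<open>The unit laws are equations between total functions; they hold because \<open>f\<close>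
  is \<open>undefined\<close> outside \<open>A\<close>.\<close>

lemma compose_id:
  assumes "f \<in> A \<rightarrow>\<^sub>E B"
  shows "compose A (restrict id B) f = f" "compose A f (restrict id A) = f"
proof -
  have "f x \<in> B" if "x \<in> A" for x
    using assms that by (rule PiE_mem)
  moreover have "f x = undefined" if "x \<notin> A" for x
    using assms that by (rule PiE_arb)
  ultimately show "compose A (restrict id B) f = f" "compose A f (restrict id A) = f"
    by (simp_all add: compose_def restrict_def fun_eq_iff)
qed

text \<open>Common shape of the two categories of the theorem: an object has two carriers, an arrow
  is a pair of extensional maps. The category axioms and a criterion for isomorphisms are proved
  here once for both. The assumption \<open>inverse\<close> says that the inverse maps of a
  bijective arrow form an arrow again.\<close>

locale pair_category =
  fixes P :: "'o \<Rightarrow> bool" and Q :: "('o, 'u) pair_arrow \<Rightarrow> bool" and A\<^sub>1 A\<^sub>0 :: "'o \<Rightarrow> 'u set"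
  assumes src: "Q f \<Longrightarrow> P (Src f)"
    and tgt: "Q f \<Longrightarrow> P (Tgt f)"
    and map\<^sub>1: "Q f \<Longrightarrow> map\<^sub>1 f \<in> A\<^sub>1 (Src f) \<rightarrow>\<^sub>E A\<^sub>1 (Tgt f)"
    and map\<^sub>0: "Q f \<Longrightarrow> map\<^sub>0 f \<in> A\<^sub>0 (Src f) \<rightarrow>\<^sub>E A\<^sub>0 (Tgt f)"
    and ident: "P X \<Longrightarrow>
      Q \<lparr>Src = X, Tgt = X, map\<^sub>1 = restrict id (A\<^sub>1 X), map\<^sub>0 = restrict id (A\<^sub>0 X)\<rparr>"
    and comp: "Q f \<Longrightarrow> Q g \<Longrightarrow> Tgt f = Src g \<Longrightarrow>
      Q \<lparr>Src = Src f, Tgt = Tgt g,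
         map\<^sub>1 = compose (A\<^sub>1 (Src f)) (map\<^sub>1 g) (map\<^sub>1 f),
         map\<^sub>0 = compose (A\<^sub>0 (Src f)) (map\<^sub>0 g) (map\<^sub>0 f)\<rparr>"
    and inverse: "Q f \<Longrightarrow> bij_betw (map\<^sub>1 f) (A\<^sub>1 (Src f)) (A\<^sub>1 (Tgt f)) \<Longrightarrow>
      bij_betw (map\<^sub>0 f) (A\<^sub>0 (Src f)) (A\<^sub>0 (Tgt f)) \<Longrightarrow>
      Q \<lparr>Src = Tgt f, Tgt = Src f,
         map\<^sub>1 = restrict (inv_into (A\<^sub>1 (Src f)) (map\<^sub>1 f)) (A\<^sub>1 (Tgt f)),
         map\<^sub>0 = restrict (inv_into (A\<^sub>0 (Src f)) (map\<^sub>0 f)) (A\<^sub>0 (Tgt f))\<rparr>"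
begin

definition cat :: "('o, ('o, 'u) pair_arrow) category" where
  "cat = \<lparr>Obj = {X. P X}, Arr = {f. Q f}, Dom = Src, Cod = Tgt,
    Ident = (\<lambda>X. \<lparr>Src = X, Tgt = X, map\<^sub>1 = restrict id (A\<^sub>1 X), map\<^sub>0 = restrict id (A\<^sub>0 X)\<rparr>),
    Comp = (\<lambda>g f. \<lparr>Src = Src f, Tgt = Tgt g,
      map\<^sub>1 = compose (A\<^sub>1 (Src f)) (map\<^sub>1 g) (map\<^sub>1 f),
      map\<^sub>0 = compose (A\<^sub>0 (Src f)) (map\<^sub>0 g) (map\<^sub>0 f)\<rparr>)\<rparr>"

lemma category: "category cat"
proof
  fix f X Y assume "f \<in> Hom cat X Y"
  then have f: "Q f" "Src f = X" "Tgt f = Y"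
    by (auto simp: Hom_def cat_def)
  show "Comp cat (Ident cat Y) f = f" "Comp cat f (Ident cat X) = f"
    using compose_id[OF map\<^sub>1[OF f(1)]] compose_id[OF map\<^sub>0[OF f(1)]] f(2,3)
    by (simp_all add: cat_def)
next
  fix f g h W X Y Z
  assume "f \<in> Hom cat W X" "g \<in> Hom cat X Y" "h \<in> Hom cat Y Z"
  then have f: "Q f" "Src f = W" "Tgt f = X" and g: "Q g" "Src g = X" "Tgt g = Y"
    and h: "Q h" "Src h = Y"
    by (auto simp: Hom_def cat_def)
  show "Comp cat h (Comp cat g f) = Comp cat (Comp cat h g) f"
    using compose_assoc[of "map\<^sub>1 f" "A\<^sub>1 W" "A\<^sub>1 X" "map\<^sub>1 h" "map\<^sub>1 g"]
      compose_assoc[of "map\<^sub>0 f" "A\<^sub>0 W" "A\<^sub>0 X" "map\<^sub>0 h" "map\<^sub>0 g"]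
      map\<^sub>1[OF f(1)] map\<^sub>0[OF f(1)] f(2,3) g(2,3) h(2)
    by (simp add: cat_def PiE_def)
qed (auto simp: cat_def Hom_def src tgt ident comp)

text \<open>The inverse arrow consists of the inverse functions, restricted to the target carriers,
  so that both composites equal the restricted identities exactly.\<close>

lemma invertibleI:
  assumes f: "Q f" and b1: "bij_betw (map\<^sub>1 f) (A\<^sub>1 (Src f)) (A\<^sub>1 (Tgt f))"
    and b0: "bij_betw (map\<^sub>0 f) (A\<^sub>0 (Src f)) (A\<^sub>0 (Tgt f))"
  shows "invertible cat f"
proof -
  have left: "compose A (restrict (inv_into A h) B) h = restrict id A"
    and right: "compose B h (restrict (inv_into A h) B) = restrict id B"
    if "bij_betw h A B" for h :: "'u \<Rightarrow> 'u" and A B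
    using that bij_betw_inv_into_left[OF that] bij_betw_inv_into_right[OF that] bij_betwE[OF that]
    by (simp_all add: compose_def restrict_def fun_eq_iff)
  let ?g = "\<lparr>Src = Tgt f, Tgt = Src f,
    map\<^sub>1 = restrict (inv_into (A\<^sub>1 (Src f)) (map\<^sub>1 f)) (A\<^sub>1 (Tgt f)),
    map\<^sub>0 = restrict (inv_into (A\<^sub>0 (Src f)) (map\<^sub>0 f)) (A\<^sub>0 (Tgt f))\<rparr>"
  have "?g \<in> Hom cat (Cod cat f) (Dom cat f)"
    using inverse[OF f b1 b0] by (simp add: cat_def Hom_def)
  moreover have "Comp cat ?g f = Ident cat (Dom cat f)" "Comp cat f ?g = Ident cat (Cod cat f)"
    using left[OF b1] left[OF b0] right[OF b1] right[OF b0] by (simp_all add: cat_def)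
  moreover have "f \<in> Arr cat"
    using f by (simp add: cat_def)
  ultimately show ?thesis
    unfolding invertible_def by blast
qed

end

section \<open>The category of crossed modules\<close>

lemma xmod_arrow_iff:
  "xmod_arrow K f \<longleftrightarrow>
    crossed_module K (Src f) \<and> crossed_module K (Tgt f) \<and>
    map\<^sub>1 f \<in> leibniz_hom K (top_alg (Src f)) (top_alg (Tgt f)) \<and>
    map\<^sub>1 f \<in> extensional (carrier (top_alg (Src f))) \<and>
    map\<^sub>0 f \<in> leibniz_hom K (base_alg (Src f)) (base_alg (Tgt f)) \<and>
    map\<^sub>0 f \<in> extensional (carrier (base_alg (Src f))) \<and>
    (\<forall>m \<in> carrier (top_alg (Src f)).
       map\<^sub>0 f (boundary (Src f) m) = boundary (Tgt f) (map\<^sub>1 f m)) \<and>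
    (\<forall>x \<in> carrier (base_alg (Src f)). \<forall>m \<in> carrier (top_alg (Src f)).
       map\<^sub>1 f (lact (Src f) x m) = lact (Tgt f) (map\<^sub>0 f x) (map\<^sub>1 f m) \<and>
       map\<^sub>1 f (ract (Src f) m x) = ract (Tgt f) (map\<^sub>1 f m) (map\<^sub>0 f x))"
  by (auto simp: xmod_arrow_def Let_def)

context crossed_module
begin

lemmas lact_closed [simp, intro] = bilinear_mapsD(1)[OF left_bilinear]
  and lact_add_left = bilinear_mapsD(2)[OF left_bilinear]
  and lact_add_right = bilinear_mapsD(3)[OF left_bilinear]
  and lact_smult_left = bilinear_mapsD(4)[OF left_bilinear]
  and lact_smult_right = bilinear_mapsD(5)[OF left_bilinear]
  and lact_zero [simp] =
    bilinear_maps_zero[OF left_bilinear L.abelian_group M.abelian_group M.abelian_group]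
  and ract_closed [simp, intro] = bilinear_mapsD(1)[OF right_bilinear]
  and ract_add_left = bilinear_mapsD(2)[OF right_bilinear]
  and ract_add_right = bilinear_mapsD(3)[OF right_bilinear]
  and ract_smult_left = bilinear_mapsD(4)[OF right_bilinear]
  and ract_smult_right = bilinear_mapsD(5)[OF right_bilinear]
  and ract_zero [simp] =
    bilinear_maps_zero[OF right_bilinear M.abelian_group L.abelian_group M.abelian_group]

lemmas boundary_closed [simp, intro] = leibniz_homD(1)[OF boundary_hom]
  and boundary_simps [simp] = leibniz_homD(2-4)[OF boundary_hom]
    linear_maps_zero[OF leibniz_hom_linear[OF boundary_hom] M.abelian_group L.abelian_group]

end

lemma crossed_module_algebras:
  assumes "crossed_module K X"
  shows "leibniz_algebra K (top_alg X)" "leibniz_algebra K (base_alg X)"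
proof -
  interpret crossed_module K X by fact
  show "leibniz_algebra K (top_alg X)" "leibniz_algebra K (base_alg X)" ..
qed

lemma internal_category_algebras:
  assumes "internal_category K G"
  shows "leibniz_algebra K (mor_alg G)" "leibniz_algebra K (ob_alg G)"
proof -
  interpret internal_category K G by fact
  show "leibniz_algebra K (mor_alg G)" "leibniz_algebra K (ob_alg G)" ..
qed

text \<open>Used as an elimination rule: every element of the target is replaced by an image
  \<open>f x\<close> and its inverse image by \<open>x\<close>, so that a claim about the inverse
  turns into one about \<open>f\<close>.\<close>

lemma bij_betw_preimageE:
  assumes "bij_betw f A B" "y \<in> B"
  obtains x where "x \<in> A" "y = f x" "inv_into A f y = x"
  using assms by (metis bij_betw_def bij_betw_inv_into_left imageE)

lemma xmod_pair_category:
  "pair_category (crossed_module K) (xmod_arrow K :: (('k, 'u) xmod, 'u) pair_arrow \<Rightarrow> bool)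
    (\<lambda>X. carrier (top_alg X)) (\<lambda>X. carrier (base_alg X))"
proof (rule pair_category.intro)
  fix f :: "(('k, 'u) xmod, 'u) pair_arrow" assume f: "xmod_arrow K f"
  then show "crossed_module K (Src f)" "crossed_module K (Tgt f)"
    and "map\<^sub>1 f \<in> carrier (top_alg (Src f)) \<rightarrow>\<^sub>E carrier (top_alg (Tgt f))"
    and "map\<^sub>0 f \<in> carrier (base_alg (Src f)) \<rightarrow>\<^sub>E carrier (base_alg (Tgt f))"
    by (auto simp: xmod_arrow_iff PiE_def leibniz_homD)
next
  fix X :: "('k, 'u) xmod" assume X: "crossed_module K X"
  interpret crossed_module K X by fact
  show "xmod_arrow K \<lparr>Src = X, Tgt = X, map\<^sub>1 = restrict id (carrier (top_alg X)),
      map\<^sub>0 = restrict id (carrier (base_alg X))\<rparr>"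
    using X by (auto simp: xmod_arrow_iff L.restrict_id_hom M.restrict_id_hom)
next
  fix f g :: "(('k, 'u) xmod, 'u) pair_arrow"
  assume f: "xmod_arrow K f" and g: "xmod_arrow K g" and fg: "Tgt f = Src g"
  interpret crossed_module K "Src f" using f by (simp add: xmod_arrow_iff)
  note homs = f[unfolded xmod_arrow_iff] g[unfolded xmod_arrow_iff]
  have "map\<^sub>1 f m \<in> carrier (top_alg (Src g))" if "m \<in> carrier (top_alg (Src f))" for m
    using homs that fg by (auto dest: leibniz_homD(1))
  moreover have "map\<^sub>0 f x \<in> carrier (base_alg (Src g))" if "x \<in> carrier (base_alg (Src f))" for x
    using homs that fg by (auto dest: leibniz_homD(1))
  ultimately show "xmod_arrow K \<lparr>Src = Src f, Tgt = Tgt g,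
       map\<^sub>1 = compose (carrier (top_alg (Src f))) (map\<^sub>1 g) (map\<^sub>1 f),
       map\<^sub>0 = compose (carrier (base_alg (Src f))) (map\<^sub>0 g) (map\<^sub>0 f)\<rparr>"
    using homs fg
    by (auto simp: xmod_arrow_iff compose_eq crossed_module_algebras intro!: compose_leibniz_hom)
next
  fix f :: "(('k, 'u) xmod, 'u) pair_arrow"
  assume f: "xmod_arrow K f"
    and b1: "bij_betw (map\<^sub>1 f) (carrier (top_alg (Src f))) (carrier (top_alg (Tgt f)))"
    and b0: "bij_betw (map\<^sub>0 f) (carrier (base_alg (Src f))) (carrier (base_alg (Tgt f)))"
  let ?g1 = "inv_into (carrier (top_alg (Src f))) (map\<^sub>1 f)"
    and ?g0 = "inv_into (carrier (base_alg (Src f))) (map\<^sub>0 f)"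
  note hom = f[unfolded xmod_arrow_iff]
  interpret X: crossed_module K "Src f" using hom by simp
  interpret Y: crossed_module K "Tgt f" using hom by simp
  \<comment> \<open>An inverse is evaluated by naming a preimage. Each compatibility of the inverse
    thus reduces to the same compatibility of \<open>f\<close>.\<close>
  have eq1: "?g1 n = m" if "m \<in> carrier (top_alg (Src f))" "n = map\<^sub>1 f m" for m n
    using b1 that by (auto simp: bij_betw_def)
  have eq0: "?g0 y = x" if "x \<in> carrier (base_alg (Src f))" "y = map\<^sub>0 f x" for x y
    using b0 that by (auto simp: bij_betw_def)
  have "?g0 (boundary (Tgt f) n) = boundary (Src f) (?g1 n)"
    if "n \<in> carrier (top_alg (Tgt f))" for n
    using hom that by (intro eq0) (auto elim!: bij_betw_preimageE[OF b1])
  moreover have "?g1 (lact (Tgt f) y n) = lact (Src f) (?g0 y) (?g1 n)"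
    "?g1 (ract (Tgt f) n y) = ract (Src f) (?g1 n) (?g0 y)"
    if "n \<in> carrier (top_alg (Tgt f))" "y \<in> carrier (base_alg (Tgt f))" for n y
    using hom that
    by (auto intro!: eq1 elim!: bij_betw_preimageE[OF b1] bij_betw_preimageE[OF b0])
  moreover have "restrict ?g1 (carrier (top_alg (Tgt f))) \<in> leibniz_hom K (top_alg (Tgt f)) (top_alg (Src f))"
    "restrict ?g0 (carrier (base_alg (Tgt f))) \<in> leibniz_hom K (base_alg (Tgt f)) (base_alg (Src f))"
    using hom by (simp_all add: inv_into_leibniz_hom[OF _ b1] inv_into_leibniz_hom[OF _ b0] crossed_module_algebras)
  ultimately show "xmod_arrow K \<lparr>Src = Tgt f, Tgt = Src f,
       map\<^sub>1 = restrict ?g1 (carrier (top_alg (Tgt f))),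
       map\<^sub>0 = restrict ?g0 (carrier (base_alg (Tgt f)))\<rparr>"
    using hom by (simp add: xmod_arrow_iff)
qed

text \<open>The \<open>rewrites\<close> clause replaces the abstract \<open>cat\<close> by
  \<open>XMod_Lbnz K\<close>, so that the results of the locale speak of the category in the
  theorem.\<close>

interpretation XMod: pair_category "crossed_module K" "xmod_arrow K"
  "\<lambda>X. carrier (top_alg X)" "\<lambda>X. carrier (base_alg X)"
  rewrites "pair_category.cat (crossed_module K) (xmod_arrow K) (\<lambda>X. carrier (top_alg X)) (\<lambda>X. carrier (base_alg X)) = XMod_Lbnz K"
  for K :: "('k, 'e) ring_scheme"
  by (rule xmod_pair_category) (simp add: pair_category.cat_def[OF xmod_pair_category] XMod_Lbnz_def)

section \<open>The category of internal categories\<close>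

lemma icat_pair_category:
  "pair_category (internal_category K) (icat_arrow K :: (('k, 'u) icat, 'u) pair_arrow \<Rightarrow> bool)
    (\<lambda>G. carrier (mor_alg G)) (\<lambda>G. carrier (ob_alg G))"
proof (rule pair_category.intro)
  fix f :: "(('k, 'u) icat, 'u) pair_arrow" assume f: "icat_arrow K f"
  then show "internal_category K (Src f)" "internal_category K (Tgt f)"
    and "map\<^sub>1 f \<in> carrier (mor_alg (Src f)) \<rightarrow>\<^sub>E carrier (mor_alg (Tgt f))"
    and "map\<^sub>0 f \<in> carrier (ob_alg (Src f)) \<rightarrow>\<^sub>E carrier (ob_alg (Tgt f))"
    by (auto simp: icat_arrow_iff PiE_def leibniz_homD)
next
  fix G :: "('k, 'u) icat" assume G: "internal_category K G"
  interpret internal_category K G by fact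
  show "icat_arrow K \<lparr>Src = G, Tgt = G, map\<^sub>1 = restrict id (carrier (mor_alg G)),
      map\<^sub>0 = restrict id (carrier (ob_alg G))\<rparr>"
    using G by (auto simp: icat_arrow_iff mor.restrict_id_hom ob.restrict_id_hom)
next
  fix f g :: "(('k, 'u) icat, 'u) pair_arrow"
  assume f: "icat_arrow K f" and g: "icat_arrow K g" and fg: "Tgt f = Src g"
  interpret internal_category K "Src f" using f by (simp add: icat_arrow_iff)
  note homs = f[unfolded icat_arrow_iff] g[unfolded icat_arrow_iff]
  have "map\<^sub>1 f m \<in> carrier (mor_alg (Src g))" if "m \<in> carrier (mor_alg (Src f))" for m
    using homs that fg by (auto dest: leibniz_homD(1))
  moreover have "map\<^sub>0 f x \<in> carrier (ob_alg (Src g))" if "x \<in> carrier (ob_alg (Src f))" for x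
    using homs that fg by (auto dest: leibniz_homD(1))
  ultimately show "icat_arrow K \<lparr>Src = Src f, Tgt = Tgt g,
       map\<^sub>1 = compose (carrier (mor_alg (Src f))) (map\<^sub>1 g) (map\<^sub>1 f),
       map\<^sub>0 = compose (carrier (ob_alg (Src f))) (map\<^sub>0 g) (map\<^sub>0 f)\<rparr>"
    using homs fg
    by (auto simp: icat_arrow_iff compose_eq internal_category_algebras intro!: compose_leibniz_hom)
next
  fix f :: "(('k, 'u) icat, 'u) pair_arrow"
  assume f: "icat_arrow K f"
    and b1: "bij_betw (map\<^sub>1 f) (carrier (mor_alg (Src f))) (carrier (mor_alg (Tgt f)))"
    and b0: "bij_betw (map\<^sub>0 f) (carrier (ob_alg (Src f))) (carrier (ob_alg (Tgt f)))"
  let ?g1 = "inv_into (carrier (mor_alg (Src f))) (map\<^sub>1 f)"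
    and ?g0 = "inv_into (carrier (ob_alg (Src f))) (map\<^sub>0 f)"
  note hom = f[unfolded icat_arrow_iff]
  interpret X: internal_category K "Src f" using hom by simp
  interpret Y: internal_category K "Tgt f" using hom by simp
  have eq1: "?g1 n = m" if "m \<in> carrier (mor_alg (Src f))" "n = map\<^sub>1 f m" for m n
    using b1 that by (auto simp: bij_betw_def)
  have eq0: "?g0 y = x" if "x \<in> carrier (ob_alg (Src f))" "y = map\<^sub>0 f x" for x y
    using b0 that by (auto simp: bij_betw_def)
  have "d\<^sub>0 (Src f) (?g1 n) = ?g0 (d\<^sub>0 (Tgt f) n)" "d\<^sub>1 (Src f) (?g1 n) = ?g0 (d\<^sub>1 (Tgt f) n)"
    if "n \<in> carrier (mor_alg (Tgt f))" for n
    using hom that by (auto intro!: eq0[symmetric] elim!: bij_betw_preimageE[OF b1])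
  moreover have "?g1 (unit_map (Tgt f) y) = unit_map (Src f) (?g0 y)"
    if "y \<in> carrier (ob_alg (Tgt f))" for y
    using hom that
    by (auto intro!: eq1 elim!: bij_betw_preimageE[OF b0])
  moreover have "restrict ?g1 (carrier (mor_alg (Tgt f))) \<in> leibniz_hom K (mor_alg (Tgt f)) (mor_alg (Src f))"
    "restrict ?g0 (carrier (ob_alg (Tgt f))) \<in> leibniz_hom K (ob_alg (Tgt f)) (ob_alg (Src f))"
    using hom by (simp_all add: inv_into_leibniz_hom[OF _ b1] inv_into_leibniz_hom[OF _ b0] internal_category_algebras)
  ultimately show "icat_arrow K \<lparr>Src = Tgt f, Tgt = Src f,
       map\<^sub>1 = restrict ?g1 (carrier (mor_alg (Tgt f))),
       map\<^sub>0 = restrict ?g0 (carrier (ob_alg (Tgt f)))\<rparr>"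
    using hom by (simp add: icat_arrow_iff)
qed

interpretation Cat: pair_category "internal_category K" "icat_arrow K"
  "\<lambda>G. carrier (mor_alg G)" "\<lambda>G. carrier (ob_alg G)"
  rewrites "pair_category.cat (internal_category K) (icat_arrow K) (\<lambda>G. carrier (mor_alg G)) (\<lambda>G. carrier (ob_alg G)) = Cat_Lbnz K"
  for K :: "('k, 'e) ring_scheme"
  by (rule icat_pair_category) (simp add: pair_category.cat_def[OF icat_pair_category] Cat_Lbnz_def)

section \<open>The crossed module of an internal category\<close>

definition kernel_alg :: "('k, 'u) icat \<Rightarrow> ('k, 'u) module" where
  "kernel_alg G =
    (mor_alg G)\<lparr>carrier := {g \<in> carrier (mor_alg G). d\<^sub>0 G g = \<zero>\<^bsub>ob_alg G\<^esub>}\<rparr>"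

lemma kernel_alg_simps [simp]:
  "carrier (kernel_alg G) = {g \<in> carrier (mor_alg G). d\<^sub>0 G g = \<zero>\<^bsub>ob_alg G\<^esub>}"
  "mult (kernel_alg G) = mult (mor_alg G)"
  "zero (kernel_alg G) = zero (mor_alg G)"
  "add (kernel_alg G) = add (mor_alg G)"
  "smult (kernel_alg G) = smult (mor_alg G)"
  by (simp_all add: kernel_alg_def)

definition icat_xmod :: "('k, 'u) icat \<Rightarrow> ('k, 'u) xmod" where
  "icat_xmod G = \<lparr>top_alg = kernel_alg G, base_alg = ob_alg G, boundary = d\<^sub>1 G,
    lact = (\<lambda>x m. unit_map G x \<otimes>\<^bsub>mor_alg G\<^esub> m), ract = (\<lambda>m x. m \<otimes>\<^bsub>mor_alg G\<^esub> unit_map G x)\<rparr>"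

lemma icat_xmod_simps [simp]:
  "top_alg (icat_xmod G) = kernel_alg G"
  "base_alg (icat_xmod G) = ob_alg G"
  "boundary (icat_xmod G) = d\<^sub>1 G"
  "lact (icat_xmod G) x m = unit_map G x \<otimes>\<^bsub>mor_alg G\<^esub> m"
  "ract (icat_xmod G) m x = m \<otimes>\<^bsub>mor_alg G\<^esub> unit_map G x"
  by (simp_all add: icat_xmod_def)

context internal_category
begin

text \<open>The kernel of the homomorphism \<open>d\<^sub>0 G\<close> is a subalgebra. Its
  differences agree with those of \<open>mor_alg G\<close>, which lets the action axioms be checked
  in the larger algebra.\<close>

lemma
  shows kernel_alg: "leibniz_algebra K (kernel_alg G)"
    and kernel_minus: "y \<in> carrier (kernel_alg G) \<Longrightarrow> x \<ominus>\<^bsub>kernel_alg G\<^esub> y = x \<ominus>\<^bsub>mor_alg G\<^esub> y"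
proof -
  have sub: "submodule {g \<in> carrier (mor_alg G). d\<^sub>0 G g = \<zero>\<^bsub>ob_alg G\<^esub>} K (mor_alg G)"
    by (rule mor.submoduleI) auto
  show "leibniz_algebra K (kernel_alg G)"
    unfolding kernel_alg_def
    by (rule leibniz_algebra_subalgebra(1)[OF mor.leibniz_algebra_axioms sub]) auto
  show "y \<in> carrier (kernel_alg G) \<Longrightarrow> x \<ominus>\<^bsub>kernel_alg G\<^esub> y = x \<ominus>\<^bsub>mor_alg G\<^esub> y"
    unfolding kernel_alg_def
    by (rule leibniz_algebra_subalgebra(2)[OF mor.leibniz_algebra_axioms sub]) auto
qed

text \<open>The action is a bracket with an identity, so all six action axioms are instances of the
  Leibniz identity in \<open>mor_alg G\<close>. Equivariance of the boundary holds because
  \<open>d\<^sub>1 G\<close> is a homomorphism that sends the identity at \<open>x\<close> to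
  \<open>x\<close>; the Peiffer identities are \<open>kernel_bracket\<close>.\<close>

lemma icat_xmod: "crossed_module K (icat_xmod G)"
proof (intro crossed_module.intro leibniz_action.intro leibniz_action_axioms.intro
    crossed_module_axioms.intro)
  show "leibniz_algebra K (base_alg (icat_xmod G))" "leibniz_algebra K (top_alg (icat_xmod G))"
    using kernel_alg ob.leibniz_algebra_axioms by simp_all
  show "lact (icat_xmod G) \<in> bilinear_maps K (base_alg (icat_xmod G)) (top_alg (icat_xmod G)) (top_alg (icat_xmod G))"
    "ract (icat_xmod G) \<in> bilinear_maps K (top_alg (icat_xmod G)) (base_alg (icat_xmod G)) (top_alg (icat_xmod G))"
    by (intro bilinear_mapsI;
        auto simp: mor.bracket_add_left mor.bracket_add_right mor.bracket_smult_left mor.bracket_smult_right)+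
  show "boundary (icat_xmod G) \<in> leibniz_hom K (top_alg (icat_xmod G)) (base_alg (icat_xmod G))"
    by (rule leibniz_homI) auto
qed (auto simp: kernel_minus kernel_bracket mor.leibniz_identity)

end

section \<open>Functoriality of the kernel construction\<close>

definition icat_xmod_arrow ::
  "(('k, 'u) icat, 'u) pair_arrow \<Rightarrow> (('k, 'u) xmod, 'u) pair_arrow" where
  "icat_xmod_arrow f = \<lparr>Src = icat_xmod (Src f), Tgt = icat_xmod (Tgt f),
    map\<^sub>1 = restrict (map\<^sub>1 f) (carrier (kernel_alg (Src f))), map\<^sub>0 = map\<^sub>0 f\<rparr>"

text \<open>Commuting with \<open>d\<^sub>0\<close> and preserving zero,
  \<open>map\<^sub>1 f\<close> sends kernel to kernel. It respects the actions because it respects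
  brackets and identities.\<close>

lemma icat_xmod_arrow:
  assumes "icat_arrow K f"
  shows "xmod_arrow K (icat_xmod_arrow f)"
proof -
  note hom = assms[unfolded icat_arrow_iff]
  interpret G: internal_category K "Src f" using hom by simp
  interpret H: internal_category K "Tgt f" using hom by simp
  have h1: "map\<^sub>1 f \<in> leibniz_hom K (mor_alg (Src f)) (mor_alg (Tgt f))"
    and h0: "map\<^sub>0 f \<in> leibniz_hom K (ob_alg (Src f)) (ob_alg (Tgt f))"
    using hom by auto
  note zero = linear_maps_zero[OF leibniz_hom_linear[OF h0] G.ob.abelian_group H.ob.abelian_group]
  have "restrict (map\<^sub>1 f) (carrier (kernel_alg (Src f))) \<in>
      leibniz_hom K (kernel_alg (Src f)) (kernel_alg (Tgt f))"
    using hom by (intro leibniz_homI) (auto simp: leibniz_homD[OF h1] zero)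
  with hom G.icat_xmod H.icat_xmod show ?thesis
    by (auto simp: xmod_arrow_iff icat_xmod_arrow_def leibniz_homD[OF h1])
qed

lemma icat_xmod_functor:
  "cat_functor (Cat_Lbnz K) (XMod_Lbnz K) icat_xmod icat_xmod_arrow"
proof (intro cat_functor.intro cat_functor_axioms.intro Cat.category XMod.category)
  fix f g G H I assume "f \<in> Hom (Cat_Lbnz K) G H" "g \<in> Hom (Cat_Lbnz K) H I"
  then have f: "icat_arrow K f" "Src f = G" "Tgt f = H" and g: "icat_arrow K g" "Src g = H"
    by (auto simp: Hom_def Cat_Lbnz_def)
  interpret G: internal_category K G using f icat_arrow_iff by auto
  interpret H: internal_category K H using f icat_arrow_iff by auto
  note hom = f(1)[unfolded icat_arrow_iff f(2,3)]
  then have h1: "map\<^sub>1 f \<in> leibniz_hom K (mor_alg G) (mor_alg H)"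
    and h0: "map\<^sub>0 f \<in> leibniz_hom K (ob_alg G) (ob_alg H)"
    by auto
  note zero = linear_maps_zero[OF leibniz_hom_linear[OF h0] G.ob.abelian_group H.ob.abelian_group]
  \<comment> \<open>The restriction inside the right-hand composite is harmless, since
    \<open>map\<^sub>1 f\<close> sends the kernel of \<open>G\<close> into that of
    \<open>H\<close>.\<close>
  show "icat_xmod_arrow (Comp (Cat_Lbnz K) g f) =
      Comp (XMod_Lbnz K) (icat_xmod_arrow g) (icat_xmod_arrow f)"
    using hom f g by (auto simp: icat_xmod_arrow_def Cat_Lbnz_def XMod_Lbnz_def compose_def fun_eq_iff
        leibniz_homD[OF h1] zero)
qed (auto simp: Hom_def Cat_Lbnz_def XMod_Lbnz_def icat_xmod_arrow_def
    icat_xmod_arrow[unfolded icat_xmod_arrow_def, simplified] internal_category.icat_xmod fun_eq_iff)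

section \<open>The internal category of a crossed module\<close>

text \<open>All carriers are subsets of the one type \<open>'u\<close>, so pairs
  \<open>(m, x)\<close> have to be coded by elements of it. Nothing is asked of elements that code
  no pair.\<close>

locale pairing =
  fixes pair :: "'u \<Rightarrow> 'u \<Rightarrow> 'u" and prl prr :: "'u \<Rightarrow> 'u"
  assumes prl_pair [simp]: "prl (pair a b) = a" and prr_pair [simp]: "prr (pair a b) = b"
begin

lemma pair_eq_iff [simp]: "pair a b = pair c d \<longleftrightarrow> a = c \<and> b = d"
  by (metis prl_pair prr_pair)

text \<open>The bracket comes from reading the pair \<open>(m, x)\<close> as
  \<open>m + \<epsilon> x\<close>: expanding \<open>[m + \<epsilon> x, n + \<epsilon> y]\<close>
  gives \<open>[m, n]\<close> and the two action terms in the kernel, and \<open>[x, y]\<close> in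
  the base.\<close>

definition semidirect :: "('k, 'u) xmod \<Rightarrow> ('k, 'u) module" where
  "semidirect X =
    \<lparr>carrier = {pair m x | m x. m \<in> carrier (top_alg X) \<and> x \<in> carrier (base_alg X)},
     mult = (\<lambda>g h. pair
       (prl g \<otimes>\<^bsub>top_alg X\<^esub> prl h \<oplus>\<^bsub>top_alg X\<^esub> (lact X (prr g) (prl h) \<oplus>\<^bsub>top_alg X\<^esub> ract X (prl g) (prr h)))
       (prr g \<otimes>\<^bsub>base_alg X\<^esub> prr h)),
     one = pair \<one>\<^bsub>top_alg X\<^esub> \<one>\<^bsub>base_alg X\<^esub>,
     zero = pair \<zero>\<^bsub>top_alg X\<^esub> \<zero>\<^bsub>base_alg X\<^esub>,
     add = (\<lambda>g h. pair (prl g \<oplus>\<^bsub>top_alg X\<^esub> prl h) (prr g \<oplus>\<^bsub>base_alg X\<^esub> prr h)),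
     smult = (\<lambda>c g. pair (c \<odot>\<^bsub>top_alg X\<^esub> prl g) (c \<odot>\<^bsub>base_alg X\<^esub> prr g))\<rparr>"

lemma semidirect_simps [simp]:
  "carrier (semidirect X) =
    {pair m x | m x. m \<in> carrier (top_alg X) \<and> x \<in> carrier (base_alg X)}"
  "pair m x \<otimes>\<^bsub>semidirect X\<^esub> pair n y =
    pair (m \<otimes>\<^bsub>top_alg X\<^esub> n \<oplus>\<^bsub>top_alg X\<^esub> (lact X x n \<oplus>\<^bsub>top_alg X\<^esub> ract X m y)) (x \<otimes>\<^bsub>base_alg X\<^esub> y)"
  "\<zero>\<^bsub>semidirect X\<^esub> = pair \<zero>\<^bsub>top_alg X\<^esub> \<zero>\<^bsub>base_alg X\<^esub>"
  "pair m x \<oplus>\<^bsub>semidirect X\<^esub> pair n y = pair (m \<oplus>\<^bsub>top_alg X\<^esub> n) (x \<oplus>\<^bsub>base_alg X\<^esub> y)"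
  "c \<odot>\<^bsub>semidirect X\<^esub> pair m x = pair (c \<odot>\<^bsub>top_alg X\<^esub> m) (c \<odot>\<^bsub>base_alg X\<^esub> x)"
  by (simp_all add: semidirect_def)

text \<open>The composition is the one dictated by \<open>comp_eq\<close>:
  \<open>(n, y) + (m, x) - (0, y) = (n + m, x)\<close>.\<close>

definition xmod_icat :: "('k, 'u) xmod \<Rightarrow> ('k, 'u) icat" where
  "xmod_icat X = \<lparr>mor_alg = semidirect X, ob_alg = base_alg X, d\<^sub>0 = prr,
    d\<^sub>1 = (\<lambda>g. boundary X (prl g) \<oplus>\<^bsub>base_alg X\<^esub> prr g), unit_map = pair \<zero>\<^bsub>top_alg X\<^esub>,
    comp_map = (\<lambda>h g. pair (prl h \<oplus>\<^bsub>top_alg X\<^esub> prl g) (prr g))\<rparr>"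

lemma xmod_icat_simps [simp]:
  "mor_alg (xmod_icat X) = semidirect X"
  "ob_alg (xmod_icat X) = base_alg X"
  "d\<^sub>0 (xmod_icat X) = prr"
  "d\<^sub>1 (xmod_icat X) (pair m x) = boundary X m \<oplus>\<^bsub>base_alg X\<^esub> x"
  "unit_map (xmod_icat X) x = pair \<zero>\<^bsub>top_alg X\<^esub> x"
  "comp_map (xmod_icat X) (pair n y) (pair m x) = pair (n \<oplus>\<^bsub>top_alg X\<^esub> m) x"
  by (simp_all add: xmod_icat_def)

end

locale crossed_module_pairing = crossed_module K X + pairing pair prl prr
  for K :: "('k, 'e) ring_scheme" (structure) and X :: "('k, 'u) xmod"
    and pair :: "'u \<Rightarrow> 'u \<Rightarrow> 'u" and prl prr
begin

section \<open>The semidirect product is a Leibniz algebra and carries an internal category\<close>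

lemma semidirect_bilinear:
  "(\<lambda>g h. g \<otimes>\<^bsub>semidirect X\<^esub> h) \<in> bilinear_maps K (semidirect X) (semidirect X) (semidirect X)"
proof (rule bilinear_mapsI, goal_cases)
  case 1 then show ?case by auto
next
  case 2 then show ?case
    by (auto simp: M.bracket_add_left L.bracket_add_left lact_add_left ract_add_left M.M.a_ac)
next
  case 3 then show ?case
    by (auto simp: M.bracket_add_right L.bracket_add_right lact_add_right ract_add_right M.M.a_ac)
next
  case 4 then show ?case
    by (auto simp: M.bracket_smult_left L.bracket_smult_left lact_smult_left ract_smult_left M.smult_r_distr)
next
  case 5 then show ?case
    by (auto simp: M.bracket_smult_right L.bracket_smult_right lact_smult_right ract_smult_right M.smult_r_distr)
qed

lemma semidirect_module: "module K (semidirect X)"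
proof (rule moduleI)
  show "abelian_group (semidirect X)"
  proof (rule abelian_groupI, goal_cases)
    case (6 g)
    then obtain m x where "g = pair m x" "m \<in> carrier (top_alg X)" "x \<in> carrier (base_alg X)"
      by auto
    then show ?case
      by (intro bexI[of _ "pair (\<ominus>\<^bsub>top_alg X\<^esub> m) (\<ominus>\<^bsub>base_alg X\<^esub> x)"]) (auto simp: M.M.l_neg L.M.l_neg)
  qed (auto simp: M.M.a_ac L.M.a_ac)
qed (auto simp: L.is_cring M.smult_l_distr L.smult_l_distr M.smult_r_distr L.smult_r_distr
    M.smult_assoc1 L.smult_assoc1)

text \<open>The action axioms without subtraction, the counterpart of
  \<open>leibniz_identity_add\<close>. Each splits one iterated product into two, as the expansion
  in \<open>semidirect\<close> requires.\<close>

lemma action_add: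
  assumes "x \<in> carrier (base_alg X)" "y \<in> carrier (base_alg X)"
    and "m \<in> carrier (top_alg X)" "n \<in> carrier (top_alg X)"
  shows "lact X x m \<otimes>\<^bsub>top_alg X\<^esub> n = lact X x (m \<otimes>\<^bsub>top_alg X\<^esub> n) \<oplus>\<^bsub>top_alg X\<^esub> lact X x n \<otimes>\<^bsub>top_alg X\<^esub> m"
    and "ract X m x \<otimes>\<^bsub>top_alg X\<^esub> n = m \<otimes>\<^bsub>top_alg X\<^esub> lact X x n \<oplus>\<^bsub>top_alg X\<^esub> ract X (m \<otimes>\<^bsub>top_alg X\<^esub> n) x"
    and "ract X (m \<otimes>\<^bsub>top_alg X\<^esub> n) x = m \<otimes>\<^bsub>top_alg X\<^esub> ract X n x \<oplus>\<^bsub>top_alg X\<^esub> ract X m x \<otimes>\<^bsub>top_alg X\<^esub> n"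
    and "lact X (x \<otimes>\<^bsub>base_alg X\<^esub> y) m = lact X x (lact X y m) \<oplus>\<^bsub>top_alg X\<^esub> ract X (lact X x m) y"
    and "ract X (lact X x m) y = lact X x (ract X m y) \<oplus>\<^bsub>top_alg X\<^esub> lact X (x \<otimes>\<^bsub>base_alg X\<^esub> y) m"
    and "ract X (ract X m x) y = ract X m (x \<otimes>\<^bsub>base_alg X\<^esub> y) \<oplus>\<^bsub>top_alg X\<^esub> ract X (ract X m y) x"
  using assms
  by (simp_all flip: M.eq_minus_iff add: action_i action_ii action_iii action_iv action_v action_vi)

lemma semidirect: "leibniz_algebra K (semidirect X)"
proof (rule leibniz_algebraI[OF L.field_axioms semidirect_module semidirect_bilinear])
  interpret S: module K "semidirect X" by (rule semidirect_module)
  note bilinear = bilinear_mapsD(1)[OF semidirect_bilinear]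
  \<comment> \<open>The general \<open>eq_minus_iff\<close> presupposes a Leibniz algebra, which is
    the claim here; the additive group of the module suffices.\<close>
  have minus_iff: "f = g \<ominus>\<^bsub>semidirect X\<^esub> h \<longleftrightarrow> g = f \<oplus>\<^bsub>semidirect X\<^esub> h"
    if "f \<in> carrier (semidirect X)" "g \<in> carrier (semidirect X)" "h \<in> carrier (semidirect X)" for f g h
    using that by (metis S.M.add.inv_solve_right a_minus_def)
  fix g h k
  assume *: "g \<in> carrier (semidirect X)" "h \<in> carrier (semidirect X)" "k \<in> carrier (semidirect X)"
  then obtain m x n y p z where eqs: "g = pair m x" "h = pair n y" "k = pair p z"
    and [simp]: "m \<in> carrier (top_alg X)" "n \<in> carrier (top_alg X)" "p \<in> carrier (top_alg X)"
      "x \<in> carrier (base_alg X)" "y \<in> carrier (base_alg X)" "z \<in> carrier (base_alg X)"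
    by auto
  \<comment> \<open>In the \<open>top_alg\<close> component, \<open>[[g, h], k]\<close> has seven terms; each splits in two by its own instance
    of the Leibniz identity or of an action axiom, which gives the fourteen terms on the right.\<close>
  note expand = M.leibniz_identity_add[of m n p] action_add(1)[of x x n p] action_add(2)[of y y m p]
    action_add(3)[of z z m n] action_add(4)[of x y p p] action_add(5)[of x z n n]
    action_add(6)[of y z m m]
  have "(g \<otimes>\<^bsub>semidirect X\<^esub> h) \<otimes>\<^bsub>semidirect X\<^esub> k =
      g \<otimes>\<^bsub>semidirect X\<^esub> (h \<otimes>\<^bsub>semidirect X\<^esub> k) \<oplus>\<^bsub>semidirect X\<^esub> (g \<otimes>\<^bsub>semidirect X\<^esub> k) \<otimes>\<^bsub>semidirect X\<^esub> h"
    unfolding eqs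
    by (simp add: L.leibniz_identity_add[of x y z] M.bracket_add_left M.bracket_add_right
        lact_add_left lact_add_right ract_add_left ract_add_right expand M.M.a_ac)
  then show "g \<otimes>\<^bsub>semidirect X\<^esub> (h \<otimes>\<^bsub>semidirect X\<^esub> k) =
      (g \<otimes>\<^bsub>semidirect X\<^esub> h) \<otimes>\<^bsub>semidirect X\<^esub> k \<ominus>\<^bsub>semidirect X\<^esub> (g \<otimes>\<^bsub>semidirect X\<^esub> k) \<otimes>\<^bsub>semidirect X\<^esub> h"
    by (subst minus_iff) (use * bilinear in blast)+
qed

text \<open>The target map respects brackets by the equivariance of the boundary. Composition
  respects brackets by the Peiffer identities: for composable \<open>(n, y)\<close> and
  \<open>(m, x)\<close> one has \<open>y = \<partial> m + x\<close>, so \<open>y\<close> acts on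
  \<open>n'\<close> as \<open>[m, n']\<close> plus the action of \<open>x\<close>, and symmetrically
  on the right.\<close>

lemma xmod_icat: "internal_category K (xmod_icat X)"
proof (intro internal_category.intro internal_category_axioms.intro)
  show "leibniz_algebra K (mor_alg (xmod_icat X))" "leibniz_algebra K (ob_alg (xmod_icat X))"
    using semidirect L.leibniz_algebra_axioms by simp_all
  show "category (underlying_category (xmod_icat X))"
    by unfold_locales (auto simp: underlying_category_def Hom_def M.M.a_assoc L.M.a_assoc)
  show "d\<^sub>0 (xmod_icat X) \<in> leibniz_hom K (mor_alg (xmod_icat X)) (ob_alg (xmod_icat X))"
    by (rule leibniz_homI) auto
  show "d\<^sub>1 (xmod_icat X) \<in> leibniz_hom K (mor_alg (xmod_icat X)) (ob_alg (xmod_icat X))"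
    by (rule leibniz_homI)
      (auto simp: L.M.a_ac L.smult_r_distr L.bracket_add_left L.bracket_add_right boundary_lact boundary_ract)
  show "unit_map (xmod_icat X) \<in> leibniz_hom K (ob_alg (xmod_icat X)) (mor_alg (xmod_icat X))"
    by (rule leibniz_homI) auto
  show "(\<lambda>(h, g). comp_map (xmod_icat X) h g)
      \<in> leibniz_hom K (composable_pairs (xmod_icat X)) (mor_alg (xmod_icat X))"
    by (rule leibniz_homI)
      (auto simp: composable_pairs_def leibniz_prod_def M.M.a_ac M.smult_r_distr
        M.bracket_add_left M.bracket_add_right lact_add_left lact_add_right ract_add_left ract_add_right
        peiffer_left peiffer_right)
qed

end

section \<open>Functoriality of the semidirect product\<close>

context pairing
begin

lemma xmod_icat: "crossed_module K X \<Longrightarrow> internal_category K (xmod_icat X)"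
  by (intro crossed_module_pairing.xmod_icat crossed_module_pairing.intro pairing_axioms)

definition xmod_icat_arrow ::
  "(('k, 'u) xmod, 'u) pair_arrow \<Rightarrow> (('k, 'u) icat, 'u) pair_arrow" where
  "xmod_icat_arrow f = \<lparr>Src = xmod_icat (Src f), Tgt = xmod_icat (Tgt f),
    map\<^sub>1 = restrict (\<lambda>g. pair (map\<^sub>1 f (prl g)) (map\<^sub>0 f (prr g))) (carrier (semidirect (Src f))),
    map\<^sub>0 = map\<^sub>0 f\<rparr>"

text \<open>Equivariance of the pair of maps gives compatibility with the semidirect bracket, and
  compatibility with the boundaries gives compatibility with targets. Composition is covered by
  \<open>icat_arrow_iff\<close>.\<close>

lemma xmod_icat_arrow:
  assumes "xmod_arrow K f"
  shows "icat_arrow K (xmod_icat_arrow f)"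
proof -
  note hom = assms[unfolded xmod_arrow_iff]
  interpret X: crossed_module K "Src f" using hom by simp
  interpret Y: crossed_module K "Tgt f" using hom by simp
  have h1: "map\<^sub>1 f \<in> leibniz_hom K (top_alg (Src f)) (top_alg (Tgt f))"
    and h0: "map\<^sub>0 f \<in> leibniz_hom K (base_alg (Src f)) (base_alg (Tgt f))"
    using hom by auto
  have h: "map\<^sub>1 (xmod_icat_arrow f) (pair m x) = pair (map\<^sub>1 f m) (map\<^sub>0 f x)"
    if "m \<in> carrier (top_alg (Src f))" "x \<in> carrier (base_alg (Src f))" for m x
    using that by (simp add: xmod_icat_arrow_def)
  note zero = linear_maps_zero[OF leibniz_hom_linear[OF h1] X.M.abelian_group Y.M.abelian_group]
  have act: "map\<^sub>1 f (lact (Src f) x m) = lact (Tgt f) (map\<^sub>0 f x) (map\<^sub>1 f m)"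
    "map\<^sub>1 f (ract (Src f) m x) = ract (Tgt f) (map\<^sub>1 f m) (map\<^sub>0 f x)"
    "map\<^sub>0 f (boundary (Src f) m) = boundary (Tgt f) (map\<^sub>1 f m)"
    if "m \<in> carrier (top_alg (Src f))" "x \<in> carrier (base_alg (Src f))" for m x
    using hom that by blast+
  have "map\<^sub>1 (xmod_icat_arrow f) \<in> leibniz_hom K (semidirect (Src f)) (semidirect (Tgt f))"
    by (rule leibniz_homI) (auto simp: h act leibniz_homD[OF h1] leibniz_homD[OF h0])
  moreover have "map\<^sub>1 (xmod_icat_arrow f) \<in> extensional (carrier (semidirect (Src f)))"
    "map\<^sub>0 (xmod_icat_arrow f) = map\<^sub>0 f"
    "Src (xmod_icat_arrow f) = xmod_icat (Src f)" "Tgt (xmod_icat_arrow f) = xmod_icat (Tgt f)"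
    by (simp_all add: xmod_icat_arrow_def)
  moreover have "map\<^sub>0 f \<in> extensional (carrier (base_alg (Src f)))"
    using hom by blast
  moreover note xmod_icat[OF X.crossed_module_axioms] xmod_icat[OF Y.crossed_module_axioms]
  ultimately show ?thesis
    unfolding icat_arrow_iff
    by (auto simp: h h0 act zero leibniz_homD[OF h1] leibniz_homD[OF h0])
qed

lemma xmod_icat_functor:
  fixes K :: "('k, 'e) ring_scheme"
  shows "cat_functor (XMod_Lbnz K) (Cat_Lbnz K) xmod_icat xmod_icat_arrow"
proof (intro cat_functor.intro cat_functor_axioms.intro Cat.category XMod.category)
  fix f g and X Y Z :: "('k, 'u) xmod" assume "f \<in> Hom (XMod_Lbnz K) X Y" "g \<in> Hom (XMod_Lbnz K) Y Z"
  then have f: "xmod_arrow K f" "Src f = X" "Tgt f = Y" and g: "xmod_arrow K g" "Src g = Y"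
    by (auto simp: Hom_def XMod_Lbnz_def)
  note hom = f(1)[unfolded xmod_arrow_iff f(2,3)]
  then have h1: "map\<^sub>1 f \<in> leibniz_hom K (top_alg X) (top_alg Y)"
    and h0: "map\<^sub>0 f \<in> leibniz_hom K (base_alg X) (base_alg Y)"
    by auto
  show "xmod_icat_arrow (Comp (XMod_Lbnz K) g f) =
      Comp (Cat_Lbnz K) (xmod_icat_arrow g) (xmod_icat_arrow f)"
    using f g by (auto simp: xmod_icat_arrow_def Cat_Lbnz_def XMod_Lbnz_def compose_def fun_eq_iff
        leibniz_homD[OF h1] leibniz_homD[OF h0])
next
  fix f and X Y :: "('k, 'u) xmod" assume "f \<in> Hom (XMod_Lbnz K) X Y"
  then have f: "xmod_arrow K f" "Src f = X" "Tgt f = Y"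
    by (simp_all add: Hom_def XMod_Lbnz_def)
  have "Src (xmod_icat_arrow f) = xmod_icat X" "Tgt (xmod_icat_arrow f) = xmod_icat Y"
    by (simp_all add: xmod_icat_arrow_def f)
  then show "xmod_icat_arrow f \<in> Hom (Cat_Lbnz K) (xmod_icat X) (xmod_icat Y)"
    using xmod_icat_arrow[OF f(1)] by (simp add: Hom_def Cat_Lbnz_def)
qed (auto simp: Cat_Lbnz_def XMod_Lbnz_def xmod_icat_arrow_def xmod_icat fun_eq_iff)

section \<open>The equivalence\<close>

definition xmod_unit :: "('k, 'u) xmod \<Rightarrow> (('k, 'u) xmod, 'u) pair_arrow" where
  "xmod_unit X = \<lparr>Src = X, Tgt = icat_xmod (xmod_icat X),
    map\<^sub>1 = restrict (\<lambda>m. pair m \<zero>\<^bsub>base_alg X\<^esub>) (carrier (top_alg X)),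
    map\<^sub>0 = restrict id (carrier (base_alg X))\<rparr>"

text \<open>The kernel of \<open>prr\<close> on \<open>semidirect X\<close> consists of the pairs
  \<open>(m, 0)\<close>, so both components are bijective. Bracketing \<open>(m, 0)\<close> with
  \<open>(0, x)\<close> recovers the original actions because zero acts as zero.\<close>

lemma xmod_unit:
  assumes X: "crossed_module K X"
  shows "xmod_arrow K (xmod_unit X)" and "invertible (XMod_Lbnz K) (xmod_unit X)"
proof -
  interpret crossed_module K X by fact
  interpret G: internal_category K "xmod_icat X" using X by (rule xmod_icat)
  have "map\<^sub>1 (xmod_unit X) \<in> leibniz_hom K (top_alg X) (kernel_alg (xmod_icat X))"
    by (rule leibniz_homI) (auto simp: xmod_unit_def)
  then show arrow: "xmod_arrow K (xmod_unit X)"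
    using X G.icat_xmod L.restrict_id_hom by (auto simp: xmod_arrow_iff xmod_unit_def)
  show "invertible (XMod_Lbnz K) (xmod_unit X)"
    by (rule XMod.invertibleI[OF arrow]) (auto simp: xmod_unit_def bij_betw_def inj_on_def image_iff)
qed

definition icat_counit :: "('k, 'u) icat \<Rightarrow> (('k, 'u) icat, 'u) pair_arrow" where
  "icat_counit G = \<lparr>Src = xmod_icat (icat_xmod G), Tgt = G,
    map\<^sub>1 = restrict (\<lambda>g. prl g \<oplus>\<^bsub>mor_alg G\<^esub> unit_map G (prr g)) (carrier (semidirect (icat_xmod G))),
    map\<^sub>0 = restrict id (carrier (ob_alg G))\<rparr>"

text \<open>Every morphism \<open>g\<close> splits uniquely into a kernel part and an identity,
  \<open>g = (g - \<epsilon>(d\<^sub>0 g)) + \<epsilon>(d\<^sub>0 g)\<close>. The map respects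
  brackets by bilinearity, the actions of \<open>icat_xmod G\<close> being brackets with
  identities.\<close>

lemma icat_counit:
  assumes G: "internal_category K G"
  shows "icat_arrow K (icat_counit G)" and "invertible (Cat_Lbnz K) (icat_counit G)"
proof -
  interpret internal_category K G by fact
  interpret H: internal_category K "xmod_icat (icat_xmod G)" by (intro xmod_icat icat_xmod)
  let ?f = "map\<^sub>1 (icat_counit G)" and ?S = "semidirect (icat_xmod G)"
  have f: "?f (pair m x) = m \<oplus>\<^bsub>mor_alg G\<^esub> unit_map G x"
    if "m \<in> carrier (mor_alg G)" "d\<^sub>0 G m = \<zero>\<^bsub>ob_alg G\<^esub>" "x \<in> carrier (ob_alg G)" for m x
    using that by (simp add: icat_counit_def)
  have "?f \<in> leibniz_hom K ?S (mor_alg G)"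
    by (rule leibniz_homI)
      (auto simp: f mor.M.a_ac mor.smult_r_distr mor.bracket_add_left mor.bracket_add_right)
  moreover have "?f \<in> extensional (carrier ?S)"
    by (simp add: icat_counit_def)
  moreover have sel: "map\<^sub>0 (icat_counit G) = restrict id (carrier (ob_alg G))"
    "Src (icat_counit G) = xmod_icat (icat_xmod G)" "Tgt (icat_counit G) = G"
    by (simp_all add: icat_counit_def)
  moreover note G H.internal_category_axioms ob.restrict_id_hom
  ultimately show arrow: "icat_arrow K (icat_counit G)"
    unfolding icat_arrow_iff by (auto simp: f)
  have "inj_on ?f (carrier ?S)"
  proof (rule inj_onI)
    fix g h assume "g \<in> carrier ?S" "h \<in> carrier ?S" and eq: "?f g = ?f h"
    then obtain m x n y where g: "g = pair m x" "m \<in> carrier (mor_alg G)" "d\<^sub>0 G m = \<zero>\<^bsub>ob_alg G\<^esub>" "x \<in> carrier (ob_alg G)"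
      and h: "h = pair n y" "n \<in> carrier (mor_alg G)" "d\<^sub>0 G n = \<zero>\<^bsub>ob_alg G\<^esub>" "y \<in> carrier (ob_alg G)"
      by auto
    have *: "m \<oplus>\<^bsub>mor_alg G\<^esub> unit_map G x = n \<oplus>\<^bsub>mor_alg G\<^esub> unit_map G y"
      using eq g h by (simp add: f)
    \<comment> \<open>The source map kills the kernel parts and leaves the objects; cancelling the
      common identity then gives \<open>m = n\<close>.\<close>
    have "x = y"
      using arg_cong[OF *, of "d\<^sub>0 G"] g h by simp
    with * show "g = h"
      using g h by simp
  qed
  moreover have "g \<in> ?f ` carrier ?S" if g: "g \<in> carrier (mor_alg G)" for g
  proof
    let ?m = "g \<ominus>\<^bsub>mor_alg G\<^esub> unit_map G (d\<^sub>0 G g)"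
    have m: "?m \<in> carrier (mor_alg G)" "d\<^sub>0 G ?m = \<zero>\<^bsub>ob_alg G\<^esub>"
      using g by (simp_all add: a_minus_def ob.M.r_neg)
    then show "pair ?m (d\<^sub>0 G g) \<in> carrier ?S"
      using g by simp
    show "g = ?f (pair ?m (d\<^sub>0 G g))"
      using g m by (simp add: f) (simp add: a_minus_def mor.M.a_assoc mor.M.l_neg)
  qed
  moreover have "?f ` carrier ?S \<subseteq> carrier (mor_alg G)"
    by (auto simp: f)
  ultimately have "bij_betw ?f (carrier ?S) (carrier (mor_alg G))"
    by (auto simp: bij_betw_def)
  moreover have "bij_betw (restrict id A) A A" for A :: "'u set"
    by (simp add: bij_betw_def inj_on_def)
  ultimately show "invertible (Cat_Lbnz K) (icat_counit G)"
    by (intro Cat.invertibleI[OF arrow]) (simp_all only: sel xmod_icat_simps icat_xmod_simps)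
qed

text \<open>On \<open>m\<close> both sides of the square give \<open>(f\<^sub>1 m, 0)\<close>,
  because \<open>f\<^sub>0\<close> preserves zero.\<close>

lemma xmod_unit_natural:
  fixes K :: "('k, 'e) ring_scheme"
  shows "natural_isomorphism (XMod_Lbnz K) (XMod_Lbnz K) id id
    (icat_xmod \<circ> xmod_icat) (icat_xmod_arrow \<circ> xmod_icat_arrow) xmod_unit"
proof (intro natural_isomorphism.intro natural_isomorphism_axioms.intro functor_id XMod.category
    functor_comp[OF xmod_icat_functor icat_xmod_functor])
  fix f and X Y :: "('k, 'u) xmod" assume "f \<in> Hom (XMod_Lbnz K) X Y"
  then have f: "xmod_arrow K f" "Src f = X" "Tgt f = Y"
    by (auto simp: Hom_def XMod_Lbnz_def)
  note hom = f(1)[unfolded xmod_arrow_iff f(2,3)]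
  interpret X: crossed_module K X using hom by simp
  interpret Y: crossed_module K Y using hom by simp
  have h1: "map\<^sub>1 f \<in> leibniz_hom K (top_alg X) (top_alg Y)"
    and h0: "map\<^sub>0 f \<in> leibniz_hom K (base_alg X) (base_alg Y)"
    using hom by auto
  show "Comp (XMod_Lbnz K) ((icat_xmod_arrow \<circ> xmod_icat_arrow) f) (xmod_unit X) =
      Comp (XMod_Lbnz K) (xmod_unit Y) (id f)"
    using f by (auto simp: XMod_Lbnz_def icat_xmod_arrow_def xmod_icat_arrow_def xmod_unit_def
        compose_def fun_eq_iff leibniz_homD[OF h1] leibniz_homD[OF h0]
        linear_maps_zero[OF leibniz_hom_linear[OF h0] X.L.abelian_group Y.L.abelian_group])
next
  fix X :: "('k, 'u) xmod" assume "X \<in> Obj (XMod_Lbnz K)"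
  then have X: "crossed_module K X" by (simp add: XMod_Lbnz_def)
  show "invertible (XMod_Lbnz K) (xmod_unit X)"
    using X by (rule xmod_unit)
  show "xmod_unit X \<in> Hom (XMod_Lbnz K) (id X) ((icat_xmod \<circ> xmod_icat) X)"
    using xmod_unit(1)[OF X] by (simp add: Hom_def XMod_Lbnz_def) (simp add: xmod_unit_def)
qed

text \<open>On \<open>(m, x)\<close> both sides of the square give
  \<open>f\<^sub>1 m + \<epsilon>(f\<^sub>0 x)\<close>, because \<open>f\<^sub>1\<close> is additive
  and commutes with identities.\<close>

lemma icat_counit_natural:
  fixes K :: "('k, 'e) ring_scheme"
  shows "natural_isomorphism (Cat_Lbnz K) (Cat_Lbnz K)
    (xmod_icat \<circ> icat_xmod) (xmod_icat_arrow \<circ> icat_xmod_arrow) id id icat_counit"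
proof (intro natural_isomorphism.intro natural_isomorphism_axioms.intro functor_id Cat.category
    functor_comp[OF icat_xmod_functor xmod_icat_functor])
  fix f and G H :: "('k, 'u) icat" assume "f \<in> Hom (Cat_Lbnz K) G H"
  then have f: "icat_arrow K f" "Src f = G" "Tgt f = H"
    by (auto simp: Hom_def Cat_Lbnz_def)
  note hom = f(1)[unfolded icat_arrow_iff f(2,3)]
  interpret G: internal_category K G using hom by simp
  interpret H: internal_category K H using hom by simp
  have h1: "map\<^sub>1 f \<in> leibniz_hom K (mor_alg G) (mor_alg H)"
    and h0: "map\<^sub>0 f \<in> leibniz_hom K (ob_alg G) (ob_alg H)"
    using hom by auto
  show "Comp (Cat_Lbnz K) (id f) (icat_counit G) =
      Comp (Cat_Lbnz K) (icat_counit H) ((xmod_icat_arrow \<circ> icat_xmod_arrow) f)"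
    using hom by (auto simp: f(2,3) Cat_Lbnz_def icat_xmod_arrow_def xmod_icat_arrow_def icat_counit_def
        compose_def fun_eq_iff leibniz_homD[OF h1] leibniz_homD[OF h0]
        linear_maps_zero[OF leibniz_hom_linear[OF h0] G.ob.abelian_group H.ob.abelian_group])
next
  fix G :: "('k, 'u) icat" assume "G \<in> Obj (Cat_Lbnz K)"
  then have G: "internal_category K G" by (simp add: Cat_Lbnz_def)
  show "invertible (Cat_Lbnz K) (icat_counit G)"
    using G by (rule icat_counit)
  show "icat_counit G \<in> Hom (Cat_Lbnz K) ((xmod_icat \<circ> icat_xmod) G) (id G)"
    using icat_counit(1)[OF G] by (simp add: Hom_def Cat_Lbnz_def) (simp add: icat_counit_def)
qed

lemma equivalence:
  fixes K :: "('k, 'e) ring_scheme"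
  shows "naturally_equivalent
    (XMod_Lbnz K :: (('k, 'u) xmod, (('k, 'u) xmod, 'u) pair_arrow) category)
    (Cat_Lbnz K :: (('k, 'u) icat, (('k, 'u) icat, 'u) pair_arrow) category)"
  unfolding naturally_equivalent_def
  by (intro exI conjI) (rule xmod_icat_functor icat_xmod_functor xmod_unit_natural icat_counit_natural)+

end

text \<open>An infinite set has the cardinality of its square. A bijection \<open>e\<close> from the
  square codes pairs, and its inverse yields the projections.\<close>

lemma infinite_pairing:
  assumes "infinite (UNIV :: 'u set)"
  obtains pair :: "'u \<Rightarrow> 'u \<Rightarrow> 'u" and prl prr where "pairing pair prl prr"
proof -
  have "(card_of (UNIV \<times> UNIV :: ('u \<times> 'u) set), card_of (UNIV :: 'u set)) \<in> ordIso"
    using assms by (rule card_of_Times_same_infinite)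
  then obtain e :: "'u \<times> 'u \<Rightarrow> 'u" where "bij_betw e (UNIV \<times> UNIV) UNIV"
    using card_of_ordIso by blast
  then have "inv_into UNIV e (e p) = p" for p
    by (auto simp: bij_betw_def)
  then have "pairing (curry e) (fst \<circ> inv_into UNIV e) (snd \<circ> inv_into UNIV e)"
    by unfold_locales simp_all
  then show ?thesis by (rule that)
qed

theorem theorem3p8:
  fixes K :: "('k, 'e) ring_scheme"
  assumes "field K"
    and "infinite (UNIV :: 'u set)"
  shows "naturally_equivalent
           (XMod_Lbnz K :: (('k, 'u) xmod, (('k, 'u) xmod, 'u) pair_arrow) category)
           (Cat_Lbnz K :: (('k, 'u) icat, (('k, 'u) icat, 'u) pair_arrow) category)
       \<and> (Grpd_Lbnz K :: (('k, 'u) icat, (('k, 'u) icat, 'u) pair_arrow) category) = Cat_Lbnz K"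
proof
  obtain pair :: "'u \<Rightarrow> 'u \<Rightarrow> 'u" and prl prr where "pairing pair prl prr"
    using infinite_pairing[OF assms(2)] .
  then interpret pairing pair prl prr .
  show "naturally_equivalent
      (XMod_Lbnz K :: (('k, 'u) xmod, (('k, 'u) xmod, 'u) pair_arrow) category)
    (Cat_Lbnz K :: (('k, 'u) icat, (('k, 'u) icat, 'u) pair_arrow) category)"
    by (rule equivalence)
  show "(Grpd_Lbnz K :: (('k, 'u) icat, (('k, 'u) icat, 'u) pair_arrow) category) = Cat_Lbnz K"
    \<comment> \<open>Every internal category is a groupoid, so the full subcategory keeps all
      objects and all arrows.\<close>
    by (auto simp: Grpd_Lbnz_def full_subcategory_def Cat_Lbnz_def internal_groupoid_iff
        icat_arrow_iff)
qed

end
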